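(* Let $A=\begin{bmatrix} a & b\\ c & d\end{bmatrix}$ be a real $2\times 2$ constant matrix. The system $\boldsymbol{x}'(t)=A\boldsymbol{x}(t)$, $t\in\mathbb{R}$, is Hyers-Ulam stable on $\mathbb{R}$ if and only if both eigenvalues of $A$ (in $\mathbb{C}$) have non-zero real part. In the case of stability, the best (minimal) Hyers-Ulam constant $K$ satisfies $K\ge \|A^{-1}\|_\infty$, with equality in some cases; in particular, if either (1) $A$ has distinct real eigenvalues $\lambda_1>\lambda_2$ with $\lambda_1\lambda_2>0$ and $\lambda_1\ge a\ge\lambda_2$, or (2) $A$ has a repeated real eigenvalue $\lambda\neq 0$ with $\lambda=a$ (so that $bc=0$), then the best (minimal) Hyers-Ulam constant is $\|A^{-1}\|_\infty$.
   Context: For $\boldsymbol{v}=(v_1,v_2)^T\in\mathbb{R}^2$, $\|\boldsymbol{v}\|_\infty=\max\{|v_1|,|v_2|\}$, and for a real $2\times2$ matrix $M=(m_{ij})$, $\|M\|_\infty=\max_{i=1,2}\{|m_{i1}|+|m_{i2}|\}$ (the induced matrix norm). The system $\boldsymbol{x}'=A\boldsymbol{x}$ is Hyers-Ulam stable on $\mathbb{R}$ if there is a constant $K>0$ such that for every $\varepsilon>0$ and every differentiable $\boldsymbol{\phi}:\mathbb{R}\to\mathbb{R}^2$ with $\|\boldsymbol{\phi}'(t)-A\boldsymbol{\phi}(t)\|_\infty\le\varepsilon$ for all $t\in\mathbb{R}$, there exists a solution $\boldsymbol{x}:\mathbb{R}\to\mathbb{R}^2$ of $\boldsymbol{x}'=A\boldsymbol{x}$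 with $\|\boldsymbol{\phi}(t)-\boldsymbol{x}(t)\|_\infty\le K\varepsilon$ for all $t\in\mathbb{R}$. Any such $K$ is called a Hyers-Ulam stability (HUS) constant. The best (minimal) HUS constant is the smallest element of the set of all HUS constants; a lower bound for the minimal constant means that the bound holds for every HUS constant. *)

theory Defs
  imports "HOL-Analysis.Analysis" "HOL-Computational_Algebra.Polynomial"
begin

text \<open>The maximum norm of a vector is the library's \<open>infnorm\<close>; see \<open>infnorm_2\<close>.\<close>

definition matrix_infnorm :: "real ^ 'n ^ 'm \<Rightarrow> real" where
  "matrix_infnorm M = (MAX i. \<Sum>j\<in>UNIV. \<bar>M $ i $ j\<bar>)"

lemma matrix_infnorm_2:
  "matrix_infnorm (M :: real ^ 2 ^ 2) =
     max (\<bar>M $ 1 $ 1\<bar> + \<bar>M $ 1 $ 2\<bar>) (\<bar>M $ 2 $ 1\<bar> + \<bar>M $ 2 $ 2\<bar>)"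
  by (simp add: matrix_infnorm_def UNIV_2)

text \<open>A real matrix is complexified, so that its eigenvalues are taken in \<open>\<complex>\<close>.\<close>

definition eigenvalue :: "real ^ 'n ^ 'n \<Rightarrow> complex \<Rightarrow> bool" where
  "eigenvalue A z \<longleftrightarrow>
     (\<exists>v. v \<noteq> 0 \<and> map_matrix complex_of_real A *v v = z *s v)"

text \<open>The algebraic multiplicity of a real eigenvalue \<open>l\<close> of \<open>A\<close> is \<open>order l (charpoly A)\<close>.\<close>

definition charpoly :: "real ^ 'n ^ 'n \<Rightarrow> real poly" where
  "charpoly A = det (mat [:0, 1:] - map_matrix (\<lambda>r. [:r:]) A)"

definition solution :: "real ^ 'n ^ 'n \<Rightarrow> (real \<Rightarrow> real ^ 'n) \<Rightarrow> bool" where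
  "solution A x \<longleftrightarrow> (\<forall>t. (x has_vector_derivative A *v x t) (at t))"

definition hus_constant :: "real ^ 'n ^ 'n \<Rightarrow> real \<Rightarrow> bool" where
  "hus_constant A K \<longleftrightarrow> K > 0 \<and>
     (\<forall>\<epsilon> > 0. \<forall>\<phi> :: real \<Rightarrow> real ^ 'n.
        (\<forall>t. \<phi> differentiable (at t)) \<longrightarrow>
        (\<forall>t. infnorm (vector_derivative \<phi> (at t) - A *v \<phi> t) \<le> \<epsilon>) \<longrightarrow>
        (\<exists>x. solution A x \<and> (\<forall>t. infnorm (\<phi> t - x t) \<le> K * \<epsilon>)))"

definition hyers_ulam_stable :: "real ^ 'n ^ 'n \<Rightarrow> bool" where
  "hyers_ulam_stable A \<longleftrightarrow> (\<exists>K. hus_constant A K)"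

definition best_hus_constant :: "real ^ 'n ^ 'n \<Rightarrow> real \<Rightarrow> bool" where
  "best_hus_constant A K \<longleftrightarrow> hus_constant A K \<and> (\<forall>K'. hus_constant A K' \<longrightarrow> K \<le> K')"

end

theory Submission
  imports Defs "HOL-Real_Asymp.Real_Asymp"
begin

text \<open>
Everything rests on the scalar complex equation \<open>u' = l u + r\<close> with \<open>r\<close> bounded by \<open>R\<close>. Multiplied by
\<open>exp (- l t)\<close>, the function \<open>u\<close> has a derivative that decays exponentially in one direction of time if
\<open>Re l \<noteq> 0\<close>; hence it converges there, and its limit singles out an exact solution at distance at most
\<open>R / \<bar>Re l\<bar>\<close> from \<open>u\<close> (\<open>scalar_shadowing\<close>). If \<open>Re l = 0\<close>, the forcing \<open>exp (l t)\<close> is bounded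
but resonates, and \<open>t exp (l t)\<close> leaves every solution (\<open>resonance_unbounded\<close>).

Stability criterion. A real matrix acts separately on the real and the imaginary part of a function into
\<open>\<complex>^2\<close>, so its stability is a property of the complex matrix
(\<open>hyers_ulam_stable_iff_shadowing\<close>). That property is invariant under similarity, a complex
matrix of size two is similar to a lower triangular one, and a triangular system is two scalar equations
solved one after the other. The diagonal entries are the eigenvalues, which gives
\<open>hyers_ulam_stable_iff_hyperbolic\<close>.

Lower bound. For a hyperbolic \<open>A\<close> and a constant vector \<open>s\<close> of norm at most \<open>1\<close>, the constant \<open>- inv A s\<close> is an
approximate solution with error \<open>1\<close>. An exact solution that stays near it is bounded, hence zero, so that
\<open>inv A s\<close> has norm at most \<open>K\<close>. With \<open>s\<close> the sign pattern of a row of \<open>inv A\<close> this bounds the absolute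
sum of that row (\<open>inverse_norm_le_hus_constant\<close>).

Upper bound. If both eigenvalues are positive, the bounded error \<open>w\<close> with \<open>w' = A w + q\<close> is
\<open>w t = - \<integral> exp (A (t - s)) q s ds\<close> over \<open>s \<ge> t\<close>, and its norm is at most that of \<open>q\<close> times a row sum of
\<open>\<integral> \<bar>exp (A r)\<bar> dr\<close> over \<open>r \<le> 0\<close>, with the absolute value taken entrywise. If no entry of \<open>exp (A r)\<close>
changes sign for \<open>r \<le> 0\<close>, the absolute value may be taken outside the integral, which is \<open>inv A\<close>; the
constant is then the norm of \<open>inv A\<close> (\<open>hus_constant_inverse_norm\<close>). The conditions on \<open>a\<close> are exactly
what keeps the diagonal entries nonnegative; the off-diagonal ones are multiples of a single function.
Negative eigenvalues reduce to positive ones by reversing time.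

An approximate solution is only differentiable, so its error need not be continuous. For this reason
the integrals above never occur: each is replaced by a comparison of derivatives, that is by the mean
value inequality against an explicit antiderivative.
\<close>

section \<open>The scalar equation\<close>

lemma exp_mult_has_vector_derivative:
  fixes l :: complex
  shows "((\<lambda>t. exp (l * of_real t)) has_vector_derivative l * exp (l * of_real t)) (at t)"
proof -
  have "((\<lambda>x. l * complex_of_real x) has_vector_derivative l) (at t)"
    by (auto intro!: derivative_eq_intros)
  from field_vector_diff_chain_at[OF this DERIV_exp]
  show ?thesis by (simp add: o_def)
qed

lemma scaled_exp_has_vector_derivative:
  fixes L l :: complex
  shows "((\<lambda>t. L * exp (l * of_real t)) has_vector_derivative l * (L * exp (l * of_real t))) (at t)"
  using bounded_linear.has_vector_derivative[OF bounded_linear_mult_right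
      exp_mult_has_vector_derivative, of L l t]
  by (simp add: mult.left_commute)

lemma integrating_factor:
  fixes u r :: "real \<Rightarrow> complex"
  assumes "(u has_vector_derivative l * u t + r t) (at t)"
  shows "((\<lambda>s. exp (- l * of_real s) * u s) has_vector_derivative exp (- l * of_real t) * r t) (at t)"
  by (rule has_vector_derivative_eq_rhs
      [OF has_vector_derivative_mult[OF exp_mult_has_vector_derivative assms]])
     (simp add: algebra_simps)

lemma has_vector_derivative_reflect:
  fixes f :: "real \<Rightarrow> 'a::real_normed_vector"
  assumes "(f has_vector_derivative f') (at (- t))"
  shows "((\<lambda>s. f (- s)) has_vector_derivative - f') (at t)"
proof -
  have "(uminus has_vector_derivative -1) (at t)"
    using has_vector_derivative_minus[OF has_vector_derivative_id[of "at t"]] by simp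
  from vector_diff_chain_at[OF this assms] show ?thesis by (simp add: o_def)
qed

lemma scalar_homogeneous:
  fixes u :: "real \<Rightarrow> complex"
  assumes "\<And>t. (u has_vector_derivative l * u t) (at t)"
  shows "u t = u 0 * exp (l * of_real t)"
proof -
  have "((\<lambda>s. exp (- l * of_real s) * u s) has_vector_derivative 0) (at t within UNIV)" for t
    using integrating_factor[of u l t "\<lambda>_. 0"] assms[of t] by simp
  then obtain k where k: "exp (- l * of_real s) * u s = k" for s
    by (rule has_vector_derivative_zero_constant[OF convex_UNIV]) auto
  have "u s = k * exp (l * of_real s)" for s
    using k[of s] by (auto simp: exp_minus field_simps)
  then show ?thesis
    by simp
qed

text \<open>A real exponential with nonzero rate takes every value \<open>exp s\<close>, and \<open>exp s \<ge> 1 + s\<close> already exceeds the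
bound for a suitable \<open>s\<close>.\<close>

lemma exp_growth_bounded_imp_zero:
  fixes x c B :: real
  assumes "x \<noteq> 0" "\<And>t. \<bar>c\<bar> * exp (x * t) \<le> B"
  shows "c = 0"
proof (rule ccontr)
  assume "c \<noteq> 0"
  have "\<bar>c\<bar> + B = \<bar>c\<bar> * (1 + B / \<bar>c\<bar>)"
    using \<open>c \<noteq> 0\<close> by (simp add: field_simps)
  also have "\<dots> \<le> \<bar>c\<bar> * exp (B / \<bar>c\<bar>)"
    by (intro mult_left_mono exp_ge_add_one_self) auto
  also have "\<dots> \<le> B"
    using assms(2)[of "B / \<bar>c\<bar> / x"] \<open>x \<noteq> 0\<close> by simp
  finally show False
    using \<open>c \<noteq> 0\<close> by simp
qed

lemma scalar_bounded_imp_zero: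
  fixes u :: "real \<Rightarrow> complex"
  assumes der: "\<And>t. (u has_vector_derivative l * u t) (at t)"
    and l: "Re l \<noteq> 0" and bnd: "\<And>t. norm (u t) \<le> B"
  shows "u t = 0"
proof -
  have "norm (u 0) * exp (Re l * t) \<le> B" for t
    using bnd[of t] unfolding scalar_homogeneous[of u l t, OF der]
    by (simp add: norm_mult)
  then have "norm (u 0) = 0"
    by (intro exp_growth_bounded_imp_zero[OF l]) auto
  then show ?thesis
    using scalar_homogeneous[of u l t, OF der] by simp
qed

text \<open>For \<open>Re l > 0\<close> the function \<open>exp (- l t) u t\<close> has speed at most \<open>R exp (- Re l t)\<close>, which has the
antiderivative \<open>g\<close> below. As \<open>g\<close> tends to zero, \<open>exp (- l t) u t\<close> converges to some \<open>L\<close> at infinity and is at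
distance at most \<open>- g t\<close> from it at time \<open>t\<close>; multiplying back by \<open>exp (l t)\<close> cancels the exponential
in \<open>g\<close>.\<close>

lemma scalar_shadowing_expanding:
  fixes u r :: "real \<Rightarrow> complex"
  assumes der: "\<And>t. (u has_vector_derivative l * u t + r t) (at t)"
    and bnd: "\<And>t. norm (r t) \<le> R" and l: "Re l > 0"
  shows "\<exists>L. \<forall>t. norm (u t - L * exp (l * of_real t)) \<le> R / Re l"
proof -
  define \<psi> where "\<psi> = (\<lambda>s. exp (- l * of_real s) * u s)"
  define g where "g = (\<lambda>s. - (R / Re l) * exp (- Re l * s))"
  have d\<psi>: "(\<psi> has_vector_derivative exp (- l * of_real s) * r s) (at s)" for s
    unfolding \<psi>_def by (rule integrating_factor) (rule der)
  have dg: "(g has_vector_derivative R * exp (- Re l * s)) (at s)" for s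
    unfolding g_def has_real_derivative_iff_has_vector_derivative[symmetric] using l
    by (auto intro!: derivative_eq_intros)
  have le: "norm (\<psi> t - \<psi> s) \<le> g t - g s" if "s \<le> t" for s t
  proof (cases "s = t")
    case False
    show ?thesis
    proof (rule differentiable_bound_general[of s t \<psi> g])
      show "s < t" using that False by simp
      show "continuous_on {s..t} \<psi>" "continuous_on {s..t} g"
        by (meson continuous_at_imp_continuous_on d\<psi> dg has_vector_derivative_continuous)+
      show "norm (exp (- l * of_real x) * r x) \<le> R * exp (- Re l * x)" for x
        using mult_right_mono[OF bnd[of x], of "exp (- Re l * x)"] by (simp add: norm_mult mult.commute)
    qed (rule d\<psi> dg)+
  qed simp
  have lim0: "(\<lambda>n. g (real n)) \<longlonglongrightarrow> 0"
  proof -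
    have "filterlim (\<lambda>n. Re l * real n) at_top sequentially"
      using l by (intro filterlim_tendsto_pos_mult_at_top[OF tendsto_const _ filterlim_real_sequentially])
    then have "(\<lambda>n. exp (- (Re l * real n))) \<longlonglongrightarrow> 0"
      by (intro filterlim_compose[OF exp_at_bot] filterlim_uminus_at_bot_at_top[THEN filterlim_compose])
    then show ?thesis
      unfolding g_def using tendsto_mult_left[of _ 0 _ "- (R / Re l)"] by fastforce
  qed
  have "Cauchy (\<lambda>n. \<psi> (real n))"
  proof (rule CauchyI)
    fix e :: real assume "0 < e"
    from CauchyD[OF LIMSEQ_imp_Cauchy[OF lim0] this]
    obtain M where M: "\<And>m n. m \<ge> M \<Longrightarrow> n \<ge> M \<Longrightarrow> norm (g (real m) - g (real n)) < e" by blast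
    have "norm (\<psi> (real m) - \<psi> (real n)) \<le> norm (g (real m) - g (real n))" for m n
      using le[of "real m" "real n"] le[of "real n" "real m"]
      by (cases "m \<le> n") (auto simp: norm_minus_commute)
    with M show "\<exists>M. \<forall>m\<ge>M. \<forall>n\<ge>M. norm (\<psi> (real m) - \<psi> (real n)) < e"
      by (meson le_less_trans)
  qed
  then obtain L where L: "(\<lambda>n. \<psi> (real n)) \<longlonglongrightarrow> L"
    using Cauchy_convergent convergent_def by blast
  have est: "norm (L - \<psi> t) \<le> - g t" for t
  proof -
    have "\<forall>\<^sub>F n in sequentially. norm (\<psi> (real n) - \<psi> t) \<le> g (real n) - g t"
      using eventually_ge_at_top[of "nat \<lceil>t\<rceil>"]
      by eventually_elim (rule le, linarith)
    then have "norm (L - \<psi> t) \<le> 0 - g t"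
      by (rule tendsto_le[OF sequentially_bot, rotated -1]) (intro tendsto_intros L lim0)+
    then show ?thesis by simp
  qed
  have "norm (u t - L * exp (l * of_real t)) \<le> R / Re l" for t
  proof -
    have "u t - L * exp (l * of_real t) = - (exp (l * of_real t) * (L - \<psi> t))"
      by (simp add: \<psi>_def algebra_simps flip: mult.assoc exp_add)
    then have "norm (u t - L * exp (l * of_real t)) = exp (Re l * t) * norm (L - \<psi> t)"
      by (simp add: norm_mult)
    also have "\<dots> \<le> exp (Re l * t) * - g t"
      by (intro mult_left_mono est) auto
    also have "\<dots> = R / Re l"
      by (simp add: g_def flip: exp_add)
    finally show ?thesis .
  qed
  then show ?thesis by blast
qed

lemma scalar_shadowing:
  fixes u r :: "real \<Rightarrow> complex"
  assumes der: "\<And>t. (u has_vector_derivative l * u t + r t) (at t)"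
    and bnd: "\<And>t. norm (r t) \<le> R" and l: "Re l \<noteq> 0"
  shows "\<exists>L. \<forall>t. norm (u t - L * exp (l * of_real t)) \<le> R / \<bar>Re l\<bar>"
proof (cases "Re l > 0")
  case True
  then show ?thesis
    using scalar_shadowing_expanding[OF der bnd True] by simp
next
  case False
  have "((\<lambda>t. u (- t)) has_vector_derivative - l * u (- t) + - r (- t)) (at t)" for t
    using has_vector_derivative_reflect[OF der[of "- t"]] by simp
  from scalar_shadowing_expanding[OF this, of R] bnd False l
  obtain L where L: "norm (u (- t) - L * exp (- l * of_real t)) \<le> R / \<bar>Re l\<bar>" for t
    by fastforce
  have "norm (u t - L * exp (l * of_real t)) \<le> R / \<bar>Re l\<bar>" for t
    using L[of "- t"] by simp
  then show ?thesis by blast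
qed

text \<open>Variation of constants; a continuous \<open>g\<close> suffices because only components of exact or explicit functions
are fed into this equation.\<close>

lemma scalar_inhomogeneous_solution:
  fixes g :: "real \<Rightarrow> complex"
  assumes "continuous_on UNIV g"
  shows "\<exists>z. \<forall>t. (z has_vector_derivative m * z t + g t) (at t)"
proof -
  have "continuous_on UNIV (\<lambda>t. exp (- m * complex_of_real t) * g t)"
    using assms by (intro continuous_intros)
  then have "\<exists>F. \<forall>t. - \<infinity> < ereal t \<longrightarrow> ereal t < \<infinity> \<longrightarrow>
      (F has_vector_derivative exp (- m * of_real t) * g t) (at t)"
    by (intro einterval_antiderivative) (auto simp: continuous_on_eq_continuous_at)
  then obtain F where F: "(F has_vector_derivative exp (- m * of_real t) * g t) (at t)" for t
    by auto
  have "((\<lambda>t. exp (m * of_real t) * F t) has_vector_derivative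
          m * (exp (m * of_real t) * F t) + g t) (at t)" for t
    by (rule has_vector_derivative_eq_rhs
        [OF has_vector_derivative_mult[OF exp_mult_has_vector_derivative F]])
       (simp add: algebra_simps flip: mult.assoc exp_add)
  then show ?thesis by (intro exI[of _ "\<lambda>t. exp (m * of_real t) * F t"]) blast
qed

section \<open>Complex systems\<close>

text \<open>Stated for any normed component space, because it is applied to real vectors, to complex vectors, and
to matrices as vectors of rows.\<close>

lemma has_vector_derivative_vec_iff:
  fixes f :: "real \<Rightarrow> 'a::real_normed_vector ^ 'n"
  shows "(f has_vector_derivative f') (at t) \<longleftrightarrow>
    (\<forall>i. ((\<lambda>s. f s $ i) has_vector_derivative f' $ i) (at t))"
proof
  assume "(f has_vector_derivative f') (at t)"
  then show "\<forall>i. ((\<lambda>s. f s $ i) has_vector_derivative f' $ i) (at t)"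
    by (intro allI bounded_linear.has_vector_derivative[OF bounded_linear_vec_nth])
next
  assume "\<forall>i. ((\<lambda>s. f s $ i) has_vector_derivative f' $ i) (at t)"
  then show "(f has_vector_derivative f') (at t)"
    unfolding has_vector_derivative_def has_derivative_at_within has_derivative_within
    by (auto intro!: vec_tendstoI bounded_linear_scaleR_left)
qed

text \<open>The bounded forcing \<open>r\<close> is the error that an approximate solution \<open>y\<close> makes in the equation.\<close>

definition driven ::
  "'a::real_normed_algebra_1 ^ 'n ^ 'n \<Rightarrow> (real \<Rightarrow> 'a ^ 'n) \<Rightarrow> (real \<Rightarrow> 'a ^ 'n) \<Rightarrow> bool" where
  "driven M r y \<longleftrightarrow> (\<forall>t. (y has_vector_derivative M *v y t + r t) (at t))"

text \<open>Hyers-Ulam stability of a complex system, with the Euclidean norm: the constant \<open>C\<close> is not tracked, so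
the choice of norm is immaterial.\<close>

definition shadowing :: "complex ^ 'n ^ 'n \<Rightarrow> bool" where
  "shadowing M \<longleftrightarrow> (\<exists>C>0. \<forall>R>0. \<forall>r y. driven M r y \<longrightarrow> (\<forall>t. norm (r t) \<le> R) \<longrightarrow>
     (\<exists>Y. driven M (\<lambda>_. 0) Y \<and> (\<forall>t. norm (y t - Y t) \<le> C * R)))"

lemma norm_vec_le_sum: "norm (x :: 'a::real_normed_vector ^ 'n) \<le> (\<Sum>i\<in>UNIV. norm (x $ i))"
  by (simp add: norm_vec_def L2_set_le_sum)

lemma matrix_vector_norm_bound:
  fixes P :: "complex ^ 'n ^ 'm"
  shows "\<exists>B>0. \<forall>x. norm (P *v x) \<le> B * norm x"
  using bounded_linear.pos_bounded[OF matrix_vector_mul_bounded_linear[of P]]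
  by (auto simp: mult.commute)

lemma driven_transform:
  fixes P M T :: "complex ^ 'n ^ 'n"
  assumes "P ** M = T ** P" "driven M r y"
  shows "driven T (\<lambda>t. P *v r t) (\<lambda>t. P *v y t)"
  unfolding driven_def
proof
  fix t
  have "(y has_vector_derivative M *v y t + r t) (at t)"
    using assms(2) by (simp add: driven_def)
  from bounded_linear.has_vector_derivative[OF matrix_vector_mul_bounded_linear this, of P]
  show "((\<lambda>t. P *v y t) has_vector_derivative T *v (P *v y t) + P *v r t) (at t)"
    by (simp add: matrix_vector_right_distrib matrix_vector_mul_assoc assms(1))
qed

lemma similar_inverse:
  fixes M T P Q :: "'a::field ^ 'n ^ 'n"
  assumes "P ** M = T ** P" "P ** Q = mat 1"
  shows "Q ** T = M ** Q"
proof -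
  have QP: "Q ** P = mat 1"
    using assms(2) matrix_left_right_inverse by blast
  have "Q ** T = Q ** (T ** (P ** Q))"
    by (simp add: assms(2))
  also have "\<dots> = Q ** (P ** M) ** Q"
    by (simp add: assms(1) matrix_mul_assoc)
  also have "\<dots> = M ** Q"
    by (simp add: matrix_mul_assoc QP)
  finally show ?thesis .
qed

text \<open>A change of coordinates by \<open>P\<close> turns approximate solutions for \<open>M\<close> into approximate solutions for \<open>T\<close>, and
its inverse \<open>Q\<close> carries exact solutions back; the constant grows by the operator norms of both.\<close>

lemma shadowing_transform:
  fixes M T P Q :: "complex ^ 'n ^ 'n"
  assumes PM: "P ** M = T ** P" and PQ: "P ** Q = mat 1" and "shadowing T"
  shows "shadowing M"
proof -
  have QP: "Q ** P = mat 1"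
    using PQ matrix_left_right_inverse by blast
  obtain C where C: "C > 0" "\<And>R r y. R > 0 \<Longrightarrow> driven T r y \<Longrightarrow> (\<And>t. norm (r t) \<le> R) \<Longrightarrow>
      \<exists>Y. driven T (\<lambda>_. 0) Y \<and> (\<forall>t. norm (y t - Y t) \<le> C * R)"
    using \<open>shadowing T\<close> unfolding shadowing_def by blast
  obtain B where B: "B > 0" "\<And>x. norm (P *v x) \<le> B * norm x"
    using matrix_vector_norm_bound[of P] by blast
  obtain D where D: "D > 0" "\<And>x. norm (Q *v x) \<le> D * norm x"
    using matrix_vector_norm_bound[of Q] by blast
  have "\<exists>X. driven M (\<lambda>_. 0) X \<and> (\<forall>t. norm (x t - X t) \<le> D * C * B * R)"
    if R: "R > 0" and x: "driven M r x" and r: "\<forall>t. norm (r t) \<le> R" for R r x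
  proof -
    have "norm (P *v r t) \<le> B * R" for t
      using B(2)[of "r t"] mult_left_mono[OF r[rule_format, of t], of B] B(1) by linarith
    then obtain Y where Y: "driven T (\<lambda>_. 0) Y" "\<And>t. norm (P *v x t - Y t) \<le> C * (B * R)"
      using C(2)[OF _ driven_transform[OF PM x], of "B * R"] B(1) R by fastforce
    have "driven M (\<lambda>_. 0) (\<lambda>t. Q *v Y t)"
      using driven_transform[OF similar_inverse[OF PM PQ] Y(1)] by simp
    moreover have "norm (x t - Q *v Y t) \<le> D * C * B * R" for t
    proof -
      have "x t - Q *v Y t = Q *v (P *v x t - Y t)"
        by (simp add: matrix_vector_mult_diff_distrib matrix_vector_mul_assoc QP)
      also have "norm \<dots> \<le> D * norm (P *v x t - Y t)"
        by (rule D(2))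
      also have "\<dots> \<le> D * (C * (B * R))"
        using D(1) by (intro mult_left_mono Y(2)) auto
      finally show ?thesis by (simp add: mult.assoc)
    qed
    ultimately show ?thesis by blast
  qed
  then show ?thesis
    unfolding shadowing_def using B(1) C(1) D(1) by (intro exI[of _ "D * C * B"]) auto
qed

section \<open>Triangular systems\<close>

lemma driven_lower_triangular:
  fixes T :: "complex ^ 2 ^ 2"
  assumes "T $ 1 $ 2 = 0"
  shows "driven T r y \<longleftrightarrow>
    (\<forall>t. ((\<lambda>s. y s $ 1) has_vector_derivative T $ 1 $ 1 * y t $ 1 + r t $ 1) (at t)) \<and>
    (\<forall>t. ((\<lambda>s. y s $ 2) has_vector_derivative
       T $ 2 $ 2 * y t $ 2 + (T $ 2 $ 1 * y t $ 1 + r t $ 2)) (at t))"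
  using assms
  by (auto simp: driven_def has_vector_derivative_vec_iff forall_2 matrix_vector_mult_def sum_2
      algebra_simps)

text \<open>The first component is shadowed by some \<open>Y1\<close>. To \<open>Y1\<close> belongs a second component \<open>Z\<close> that solves the
second equation, possibly far away from \<open>y\<close>. The difference of the second components then satisfies
a scalar equation with bounded forcing, because the first components stay close, and the solution that
shadows it corrects \<open>Z\<close>.\<close>

lemma shadowing_lower_triangular_if:
  fixes T :: "complex ^ 2 ^ 2"
  assumes T: "T $ 1 $ 2 = 0" and re: "Re (T $ 1 $ 1) \<noteq> 0" "Re (T $ 2 $ 2) \<noteq> 0"
  shows "shadowing T"
proof -
  define l m k where "l = T $ 1 $ 1" and "m = T $ 2 $ 2" and "k = T $ 2 $ 1"
  define C1 C2 where "C1 = 1 / \<bar>Re l\<bar>" and "C2 = (norm k * C1 + 1) / \<bar>Re m\<bar>"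
  have pos: "C1 > 0" "C2 > 0"
    using re by (auto simp: C1_def C2_def l_def m_def intro!: divide_pos_pos add_nonneg_pos)
  have "\<exists>Y. driven T (\<lambda>_. 0) Y \<and> (\<forall>t. norm (y t - Y t) \<le> (C1 + C2) * R)"
    if "driven T r y" and r: "\<forall>t. norm (r t) \<le> R" for R r y
  proof -
    have y1: "((\<lambda>s. y s $ 1) has_vector_derivative l * y t $ 1 + r t $ 1) (at t)"
     and y2: "((\<lambda>s. y s $ 2) has_vector_derivative m * y t $ 2 + (k * y t $ 1 + r t $ 2)) (at t)" for t
      using that(1) unfolding driven_lower_triangular[OF T] l_def m_def k_def by auto
    have r': "norm (r t $ i) \<le> R" for t i
      using Finite_Cartesian_Product.norm_nth_le[of "r t" i] r by (meson order_trans)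
    obtain L where L: "norm (y t $ 1 - L * exp (l * of_real t)) \<le> C1 * R" for t
      using scalar_shadowing[OF y1 r'] re(1) by (auto simp: C1_def l_def)
    define Y1 where "Y1 = (\<lambda>t. L * exp (l * of_real t))"
    have dY1: "(Y1 has_vector_derivative l * Y1 t) (at t)" for t
      unfolding Y1_def by (rule scaled_exp_has_vector_derivative)
    have "continuous_on UNIV (\<lambda>t. k * Y1 t)"
      unfolding Y1_def by (intro continuous_intros)
    then obtain Z where Z: "(Z has_vector_derivative m * Z t + k * Y1 t) (at t)" for t
      using scalar_inhomogeneous_solution by blast
    have "((\<lambda>s. y s $ 2 - Z s) has_vector_derivative
        m * (y t $ 2 - Z t) + (k * (y t $ 1 - Y1 t) + r t $ 2)) (at t)" for t
      using has_vector_derivative_diff[OF y2 Z] by (simp add: algebra_simps)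
    moreover have "norm (k * (y t $ 1 - Y1 t) + r t $ 2) \<le> (norm k * C1 + 1) * R" for t
    proof -
      have "norm (k * (y t $ 1 - Y1 t) + r t $ 2) \<le> norm k * norm (y t $ 1 - Y1 t) + norm (r t $ 2)"
        by (metis norm_mult norm_triangle_ineq)
      also have "\<dots> \<le> norm k * (C1 * R) + R"
        by (intro add_mono mult_left_mono r' L[folded Y1_def]) (auto simp: Y1_def intro: L)
      finally show ?thesis by (simp add: algebra_simps)
    qed
    ultimately have "\<exists>N. \<forall>t. norm (y t $ 2 - Z t - N * exp (m * of_real t))
        \<le> (norm k * C1 + 1) * R / \<bar>Re m\<bar>"
      by (rule scalar_shadowing) (simp add: m_def re)
    then obtain N where
      N: "norm (y t $ 2 - Z t - N * exp (m * of_real t)) \<le> (norm k * C1 + 1) * R / \<bar>Re m\<bar>" for t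
      by blast
    define Y2 where "Y2 = (\<lambda>t. Z t + N * exp (m * of_real t))"
    have dY2: "(Y2 has_vector_derivative m * Y2 t + k * Y1 t) (at t)" for t
      unfolding Y2_def
      by (rule has_vector_derivative_eq_rhs[OF has_vector_derivative_add
          [OF Z scaled_exp_has_vector_derivative]]) (simp add: algebra_simps)
    define Y :: "real \<Rightarrow> complex ^ 2" where "Y = (\<lambda>t. vector [Y1 t, Y2 t])"
    have "driven T (\<lambda>_. 0) Y"
      unfolding driven_lower_triangular[OF T] Y_def
      using dY1 dY2 by (auto simp: l_def m_def k_def)
    moreover have "norm (y t - Y t) \<le> (C1 + C2) * R" for t
    proof -
      have "norm (y t - Y t) \<le> norm (y t $ 1 - Y1 t) + norm (y t $ 2 - Y2 t)"
        using norm_vec_le_sum[of "y t - Y t"] by (simp add: sum_2 Y_def)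
      also have "\<dots> \<le> C1 * R + C2 * R"
        using L[of t] N[of t] by (auto simp: Y1_def Y2_def C2_def diff_diff_eq intro!: add_mono)
      finally show ?thesis by (simp add: algebra_simps)
    qed
    ultimately show ?thesis by blast
  qed
  then show ?thesis
    unfolding shadowing_def using pos by (intro exI[of _ "C1 + C2"]) auto
qed

text \<open>Solutions of \<open>u' = l u\<close> have constant modulus when \<open>l\<close> is imaginary, whereas \<open>t exp (l t)\<close> has
modulus \<open>\<bar>t\<bar>\<close>.\<close>

lemma resonance_unbounded:
  fixes u :: "real \<Rightarrow> complex"
  assumes "Re l = 0" "\<And>t. (u has_vector_derivative l * u t) (at t)"
  shows "\<not> (\<forall>t. norm (of_real t * exp (l * of_real t) - u t) \<le> B)"
proof
  assume bnd: "\<forall>t. norm (of_real t * exp (l * of_real t) - u t) \<le> B"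
  define t where "t = \<bar>B\<bar> + norm (u 0) + 1"
  have "t \<ge> 0"
    by (simp add: t_def)
  then have "norm (of_real t * exp (l * of_real t)) = t" "norm (u t) = norm (u 0)"
    using assms(1) scalar_homogeneous[of u l t, OF assms(2)] by (simp_all add: norm_mult)
  then have "norm (of_real t * exp (l * of_real t) - u t) \<ge> t - norm (u 0)"
    using norm_triangle_ineq2 by metis
  then show False
    using bnd[rule_format, of t] by (auto simp: t_def)
qed

lemma resonant_has_vector_derivative:
  fixes l :: complex
  shows "((\<lambda>t. of_real t * exp (l * of_real t)) has_vector_derivative
    l * (of_real t * exp (l * of_real t)) + exp (l * of_real t)) (at t)"
proof -
  have "(complex_of_real has_vector_derivative 1) (at t)"
    by (auto intro!: derivative_eq_intros)
  from has_vector_derivative_mult[OF this exp_mult_has_vector_derivative]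
  show ?thesis
    by (rule has_vector_derivative_eq_rhs) (simp add: algebra_simps)
qed

text \<open>An imaginary diagonal entry allows resonance in its own component. In the first component the resonant
function is completed by any matching second component. In the second one, the first component of a
shadowing solution might interfere; it is bounded, and therefore zero, since the first diagonal entry
is already known to have a nonzero real part.\<close>

lemma shadowing_lower_triangular_only_if:
  fixes T :: "complex ^ 2 ^ 2"
  assumes T: "T $ 1 $ 2 = 0" and sh: "shadowing T"
  shows "Re (T $ 1 $ 1) \<noteq> 0" "Re (T $ 2 $ 2) \<noteq> 0"
proof -
  define l m k where "l = T $ 1 $ 1" and "m = T $ 2 $ 2" and "k = T $ 2 $ 1"
  obtain C where C: "\<And>r y. driven T r y \<Longrightarrow> (\<And>t. norm (r t) \<le> 1) \<Longrightarrow>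
      \<exists>Y. driven T (\<lambda>_. 0) Y \<and> (\<forall>t. norm (y t - Y t) \<le> C)"
    using sh unfolding shadowing_def by (metis mult.right_neutral zero_less_one)
  have comp: "norm (y t $ i - Y t $ i) \<le> C"
    if "\<forall>t. norm (y t - Y t) \<le> C" for y Y :: "real \<Rightarrow> complex ^ 2" and t i
    using Finite_Cartesian_Product.norm_nth_le[of "y t - Y t" i] that by (simp) (meson order_trans)
  show l: "Re (T $ 1 $ 1) \<noteq> 0"
  proof
    assume l0: "Re (T $ 1 $ 1) = 0"
    define y1 where "y1 = (\<lambda>t. of_real t * exp (l * of_real t))"
    have "continuous_on UNIV (\<lambda>t. k * y1 t)"
      unfolding y1_def by (intro continuous_intros)
    then obtain y2 where y2: "(y2 has_vector_derivative m * y2 t + k * y1 t) (at t)" for t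
      using scalar_inhomogeneous_solution by blast
    have "driven T (\<lambda>t. vector [exp (l * of_real t), 0]) (\<lambda>t. vector [y1 t, y2 t])"
      unfolding driven_lower_triangular[OF T] using y2 resonant_has_vector_derivative[of l]
      by (auto simp: l_def m_def k_def y1_def)
    moreover have "norm (vector [exp (l * of_real t), 0] :: complex ^ 2) \<le> 1" for t
      using norm_vec_le_sum[of "vector [exp (l * of_real t), 0] :: complex ^ 2"] l0
      by (simp add: sum_2 l_def)
    ultimately obtain Y where Y: "driven T (\<lambda>_. 0) Y" "\<forall>t. norm (vector [y1 t, y2 t] - Y t) \<le> C"
      using C by blast
    have "\<forall>t. norm (y1 t - Y t $ 1) \<le> C"
      using comp[OF Y(2), of _ 1] by simp
    moreover have "((\<lambda>s. Y s $ 1) has_vector_derivative l * Y t $ 1) (at t)" for t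
      using Y(1) unfolding driven_lower_triangular[OF T] by (simp add: l_def)
    ultimately show False
      using resonance_unbounded[of l "\<lambda>s. Y s $ 1" C] l0 by (auto simp: y1_def l_def)
  qed
  show "Re (T $ 2 $ 2) \<noteq> 0"
  proof
    assume m0: "Re (T $ 2 $ 2) = 0"
    define y2 where "y2 = (\<lambda>t. of_real t * exp (m * of_real t))"
    have "driven T (\<lambda>t. vector [0, exp (m * of_real t)]) (\<lambda>t. vector [0, y2 t])"
      unfolding driven_lower_triangular[OF T] using resonant_has_vector_derivative[of m]
      by (auto simp: m_def y2_def)
    moreover have "norm (vector [0, exp (m * of_real t)] :: complex ^ 2) \<le> 1" for t
      using norm_vec_le_sum[of "vector [0, exp (m * of_real t)] :: complex ^ 2"] m0
      by (simp add: sum_2 m_def)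
    ultimately obtain Y where Y: "driven T (\<lambda>_. 0) Y" "\<forall>t. norm (vector [0, y2 t] - Y t) \<le> C"
      using C by blast
    have Y1: "((\<lambda>s. Y s $ 1) has_vector_derivative l * Y t $ 1) (at t)"
     and Y2: "((\<lambda>s. Y s $ 2) has_vector_derivative m * Y t $ 2 + k * Y t $ 1) (at t)" for t
      using Y(1) unfolding driven_lower_triangular[OF T] by (simp_all add: l_def m_def k_def)
    have bnd1: "norm (Y t $ 1) \<le> C" for t
      using comp[OF Y(2), of t 1] by simp
    have "Y t $ 1 = 0" for t
      by (rule scalar_bounded_imp_zero[OF Y1 _ bnd1]) (simp add: l_def l)
    then have "((\<lambda>s. Y s $ 2) has_vector_derivative m * Y t $ 2) (at t)" for t
      using Y2[of t] by simp
    moreover have "\<forall>t. norm (y2 t - Y t $ 2) \<le> C"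
      using comp[OF Y(2), of _ 2] by simp
    ultimately show False
      using resonance_unbounded[of m "\<lambda>s. Y s $ 2" C] m0 by (auto simp: y2_def m_def)
  qed
qed

lemma bounded_solution_lower_triangular:
  fixes T :: "complex ^ 2 ^ 2"
  assumes T: "T $ 1 $ 2 = 0" and re: "Re (T $ 1 $ 1) \<noteq> 0" "Re (T $ 2 $ 2) \<noteq> 0"
    and Y: "driven T (\<lambda>_. 0) Y" and bnd: "\<And>t. norm (Y t) \<le> B"
  shows "Y t = 0"
proof -
  have comp: "norm (Y t $ i) \<le> B" for t i
    using Finite_Cartesian_Product.norm_nth_le bnd by (meson order_trans)
  have Y1: "((\<lambda>s. Y s $ 1) has_vector_derivative T $ 1 $ 1 * Y t $ 1) (at t)"
   and Y2: "((\<lambda>s. Y s $ 2) has_vector_derivative T $ 2 $ 2 * Y t $ 2 + T $ 2 $ 1 * Y t $ 1) (at t)" for t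
    using Y unfolding driven_lower_triangular[OF T] by simp_all
  have z1: "Y t $ 1 = 0" for t
    by (rule scalar_bounded_imp_zero[OF Y1 re(1) comp])
  have "Y t $ 2 = 0"
    by (rule scalar_bounded_imp_zero[OF _ re(2) comp]) (use Y2 z1 in simp)
  with z1 show ?thesis
    by (simp add: vec_eq_iff forall_2)
qed

text \<open>A left eigenvector \<open>(p, q)\<close>, taken as first row of \<open>P\<close>, makes the first row of \<open>P M inv P\<close> a multiple of
\<open>(1, 0)\<close>. The second row is orthogonal to it, so that \<open>P\<close> is invertible and \<open>n\<close> is its determinant.\<close>

lemma complex_2x2_schur:
  fixes M :: "complex ^ 2 ^ 2"
  obtains T P Q :: "complex ^ 2 ^ 2" where "P ** M = T ** P" "P ** Q = mat 1" "T $ 1 $ 2 = 0"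
proof -
  define a b c d where "a = M $ 1 $ 1" and "b = M $ 1 $ 2" and "c = M $ 2 $ 1" and "d = M $ 2 $ 2"
  obtain p q l where pq: "p \<noteq> 0 \<or> q \<noteq> 0" and left: "p * a + q * c = l * p" "p * b + q * d = l * q"
  \<comment> \<open>For \<open>c \<noteq> 0\<close> the vector \<open>(c, l - a)\<close> works for every root \<open>l\<close> of the characteristic polynomial.\<close>
  proof (cases "c = 0")
    case True
    then show ?thesis using that[of 0 1 d] by simp
  next
    case False
    define s where "s = csqrt ((a + d)\<^sup>2 - 4 * (a * d - b * c))"
    define l where "l = (a + d + s) / 2"
    have s2: "s\<^sup>2 = (a + d)\<^sup>2 - 4 * (a * d - b * c)"
      by (simp add: s_def)
    have "2 * l = a + d + s"
      by (simp add: l_def)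
    with s2 have "4 * (c * b + (l - a) * d) = 4 * (l * (l - a))"
      by algebra
    then have "c * b + (l - a) * d = l * (l - a)"
      by (subst (asm) mult_cancel_left) simp
    then show ?thesis using that[of c "l - a" l] False by (simp add: algebra_simps)
  qed
  define n where "n = p * cnj p + q * cnj q"
  have "n = of_real ((cmod p)\<^sup>2 + (cmod q)\<^sup>2)"
    by (simp only: n_def of_real_add complex_norm_square)
  then have n: "n \<noteq> 0"
    using pq by (auto simp: sum_power2_eq_zero_iff simp del: of_real_add)
  define P Q :: "complex ^ 2 ^ 2" where
    "P = vector [vector [p, q], vector [- cnj q, cnj p]]" and
    "Q = vector [vector [cnj p / n, - q / n], vector [cnj q / n, p / n]]"
  have PQ: "P ** Q = mat 1"
    using n by (simp add: P_def Q_def vec_eq_iff forall_2 matrix_matrix_mult_def sum_2 mat_def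
        mult.commute flip: add_divide_distrib) (simp add: n_def complex_norm_square add.commute)
  then have QP: "Q ** P = mat 1"
    using matrix_left_right_inverse by blast
  define T where "T = P ** M ** Q"
  have "T $ 1 $ 2 = 0"
  proof -
    have "T $ 1 $ 2 = (p * b + q * d) * p / n - (p * a + q * c) * q / n"
      by (simp add: T_def P_def Q_def matrix_matrix_mult_def sum_2 a_def b_def c_def d_def)
    then show ?thesis unfolding left by simp
  qed
  moreover have "P ** M = T ** P"
    by (simp add: T_def QP flip: matrix_mul_assoc)
  ultimately show ?thesis
    using that PQ by blast
qed

section \<open>Real systems and their complexification\<close>

definition re_vec :: "complex ^ 'n \<Rightarrow> real ^ 'n" where
  "re_vec z = (\<chi> i. Re (z $ i))"

definition im_vec :: "complex ^ 'n \<Rightarrow> real ^ 'n" where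
  "im_vec z = (\<chi> i. Im (z $ i))"

definition of_real_vec :: "real ^ 'n \<Rightarrow> complex ^ 'n" where
  "of_real_vec x = (\<chi> i. complex_of_real (x $ i))"

abbreviation complexify :: "real ^ 'n ^ 'm \<Rightarrow> complex ^ 'n ^ 'm" where
  "complexify \<equiv> map_matrix complex_of_real"

lemma re_im_of_real_vec [simp]: "re_vec (of_real_vec x) = x" "im_vec (of_real_vec x) = 0"
  "re_vec 0 = 0" "im_vec 0 = 0"
  by (simp_all add: re_vec_def im_vec_def of_real_vec_def vec_eq_iff)

text \<open>A matrix with real entries acts separately on real and imaginary parts.\<close>

lemma driven_complexify_iff:
  "driven (complexify A) r y \<longleftrightarrow>
    driven A (\<lambda>t. re_vec (r t)) (\<lambda>t. re_vec (y t)) \<and>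
    driven A (\<lambda>t. im_vec (r t)) (\<lambda>t. im_vec (y t))"
  by (simp add: driven_def has_vector_derivative_vec_iff has_vector_derivative_complex_iff
      has_real_derivative_iff_has_vector_derivative
      re_vec_def im_vec_def matrix_vector_mult_def all_conj_distrib)

lemma driven_of_real_vec:
  assumes "driven A q x"
  shows "driven (complexify A) (\<lambda>t. of_real_vec (q t)) (\<lambda>t. of_real_vec (x t))"
  using assms by (simp add: driven_complexify_iff) (simp add: driven_def has_vector_derivative_const)

lemma infnorm_le_iff: "infnorm (x :: real ^ 'n) \<le> B \<longleftrightarrow> (\<forall>i. \<bar>x $ i\<bar> \<le> B)"
proof
  show "\<forall>i. \<bar>x $ i\<bar> \<le> B" if "infnorm x \<le> B"
    using component_le_infnorm_cart that by (meson order_trans)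
  show "infnorm x \<le> B" if "\<forall>i. \<bar>x $ i\<bar> \<le> B"
    unfolding infnorm_cart using that by (intro cSup_least) auto
qed

lemma infnorm_re_vec_le: "infnorm (re_vec z) \<le> norm z" "infnorm (im_vec z) \<le> norm z"
  unfolding infnorm_le_iff re_vec_def im_vec_def
  by (auto intro: order_trans[OF abs_Re_le_cmod] order_trans[OF abs_Im_le_cmod]
      Finite_Cartesian_Product.norm_nth_le)

lemma norm_le_infnorm_parts:
  fixes z :: "complex ^ 'n"
  assumes "infnorm (re_vec z) \<le> B" "infnorm (im_vec z) \<le> C"
  shows "norm z \<le> real CARD('n) * (B + C)"
proof -
  have "norm (z $ i) \<le> B + C" for i
    using assms cmod_le[of "z $ i"] unfolding infnorm_le_iff re_vec_def im_vec_def
    by simp (smt (verit))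
  then have "(\<Sum>i\<in>UNIV. norm (z $ i)) \<le> real CARD('n) * (B + C)"
    by (rule sum_bounded_above)
  then show ?thesis
    using norm_vec_le_sum[of z] by linarith
qed

lemma solution_iff_driven: "solution A x \<longleftrightarrow> driven A (\<lambda>_. 0) x"
  by (simp add: solution_def driven_def)

lemma hus_constant_iff_driven:
  fixes A :: "real ^ 'n ^ 'n"
  shows "hus_constant A K \<longleftrightarrow> K > 0 \<and>
     (\<forall>\<epsilon> > 0. \<forall>\<phi> q. driven A q \<phi> \<longrightarrow> (\<forall>t. infnorm (q t) \<le> \<epsilon>) \<longrightarrow>
        (\<exists>x. driven A (\<lambda>_. 0) x \<and> (\<forall>t. infnorm (\<phi> t - x t) \<le> K * \<epsilon>)))"
proof -
  have "(\<forall>t. \<phi> differentiable (at t)) \<and> (\<forall>t. infnorm (vector_derivative \<phi> (at t) - A *v \<phi> t) \<le> \<epsilon>)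
    \<longleftrightarrow> (\<exists>q. driven A q \<phi> \<and> (\<forall>t. infnorm (q t) \<le> \<epsilon>))" (is "?l \<longleftrightarrow> ?r") for \<phi> :: "real \<Rightarrow> real ^ 'n" and \<epsilon>
  proof
    assume ?l
    then show ?r
      by (intro exI[of _ "\<lambda>t. vector_derivative \<phi> (at t) - A *v \<phi> t"])
         (auto simp: driven_def vector_derivative_works)
  next
    assume ?r
    then obtain q where q: "driven A q \<phi>" "\<And>t. infnorm (q t) \<le> \<epsilon>" by blast
    have "(\<phi> has_vector_derivative A *v \<phi> t + q t) (at t)" for t
      using q(1) by (simp add: driven_def)
    then show ?l
      using q(2) by (metis add_diff_cancel_left' differentiableI_vector vector_derivative_at)
  qed
  then show ?thesis
    unfolding hus_constant_def solution_iff_driven by meson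
qed

text \<open>Left to right, the real and the imaginary part of a complex approximate solution are shadowed
separately. Right to left, the real part of a complex solution close to a real function is a real
solution that is at least as close.\<close>

lemma hyers_ulam_stable_iff_shadowing:
  fixes A :: "real ^ 'n ^ 'n"
  shows "hyers_ulam_stable A \<longleftrightarrow> shadowing (complexify A)"
proof
  assume "hyers_ulam_stable A"
  then obtain K where K: "K > 0" and hus: "\<And>R q \<phi>. R > 0 \<Longrightarrow> driven A q \<phi> \<Longrightarrow> (\<And>t. infnorm (q t) \<le> R) \<Longrightarrow>
      \<exists>x. driven A (\<lambda>_. 0) x \<and> (\<forall>t. infnorm (\<phi> t - x t) \<le> K * R)"
    unfolding hyers_ulam_stable_def hus_constant_iff_driven by blast
  have "\<exists>Y. driven (complexify A) (\<lambda>_. 0) Y \<and> (\<forall>t. norm (y t - Y t) \<le> (real CARD('n) * (2 * K)) * R)"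
    if R: "R > 0" and y: "driven (complexify A) r y" and r: "\<forall>t. norm (r t) \<le> R" for R r y
  proof -
    have "infnorm (re_vec (r t)) \<le> R" "infnorm (im_vec (r t)) \<le> R" for t
      using infnorm_re_vec_le[of "r t"] r by (meson order_trans)+
    then obtain x x' where x: "driven A (\<lambda>_. 0) x" "\<And>t. infnorm (re_vec (y t) - x t) \<le> K * R"
      and x': "driven A (\<lambda>_. 0) x'" "\<And>t. infnorm (im_vec (y t) - x' t) \<le> K * R"
      using hus[OF R, of _ "\<lambda>t. re_vec (y t)"] hus[OF R, of _ "\<lambda>t. im_vec (y t)"] y
      unfolding driven_complexify_iff by metis
    define Y :: "real \<Rightarrow> complex ^ 'n" where "Y = (\<lambda>t. \<chi> i. Complex (x t $ i) (x' t $ i))"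
    have [simp]: "re_vec (Y t) = x t" "im_vec (Y t) = x' t" for t
      by (simp_all add: Y_def re_vec_def im_vec_def)
    have "driven (complexify A) (\<lambda>_. 0) Y"
      using x(1) x'(1) by (simp add: driven_complexify_iff)
    moreover have "norm (y t - Y t) \<le> (real CARD('n) * (2 * K)) * R" for t
    proof -
      have "re_vec (y t - Y t) = re_vec (y t) - x t" "im_vec (y t - Y t) = im_vec (y t) - x' t"
        by (simp_all add: Y_def re_vec_def im_vec_def vec_eq_iff)
      then have "norm (y t - Y t) \<le> real CARD('n) * (K * R + K * R)"
        by (intro norm_le_infnorm_parts) (simp_all only: x(2) x'(2))
      then show ?thesis
        by (simp add: algebra_simps)
    qed
    ultimately show ?thesis by blast
  qed
  then show "shadowing (complexify A)"
    unfolding shadowing_def using K by (intro exI[of _ "real CARD('n) * (2 * K)"]) auto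
next
  assume "shadowing (complexify A)"
  then obtain C where C: "C > 0" and sh: "\<And>R r y. R > 0 \<Longrightarrow> driven (complexify A) r y \<Longrightarrow>
      (\<And>t. norm (r t) \<le> R) \<Longrightarrow>
      \<exists>Y. driven (complexify A) (\<lambda>_. 0) Y \<and> (\<forall>t. norm (y t - Y t) \<le> C * R)"
    unfolding shadowing_def by blast
  have "\<exists>x. driven A (\<lambda>_. 0) x \<and> (\<forall>t. infnorm (\<phi> t - x t) \<le> C * real CARD('n) * R)"
    if R: "R > 0" and \<phi>: "driven A q \<phi>" and q: "\<forall>t. infnorm (q t) \<le> R" for R q \<phi>
  proof -
    have "norm (of_real_vec (q t)) \<le> real CARD('n) * R" for t
      using norm_le_infnorm_parts[of "of_real_vec (q t)" R 0] q by (simp add: infnorm_0)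
    then obtain Y where Y: "driven (complexify A) (\<lambda>_. 0) Y"
        "\<And>t. norm (of_real_vec (\<phi> t) - Y t) \<le> C * (real CARD('n) * R)"
      using sh[OF _ driven_of_real_vec[OF \<phi>]] R by (metis mult_pos_pos of_nat_0_less_iff zero_less_card_finite)
    have "driven A (\<lambda>_. 0) (\<lambda>t. re_vec (Y t))"
      using Y(1) by (simp add: driven_complexify_iff)
    moreover have "infnorm (\<phi> t - re_vec (Y t)) \<le> C * real CARD('n) * R" for t
    proof -
      have "\<phi> t - re_vec (Y t) = re_vec (of_real_vec (\<phi> t) - Y t)"
        by (simp add: re_vec_def of_real_vec_def vec_eq_iff)
      then show ?thesis
        using infnorm_re_vec_le(1)[of "of_real_vec (\<phi> t) - Y t"] Y(2)[of t]
        by (simp add: mult.assoc)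
    qed
    ultimately show ?thesis by (intro exI[of _ "\<lambda>t. re_vec (Y t)"]) blast
  qed
  then have "hus_constant A (C * real CARD('n))"
    unfolding hus_constant_iff_driven using C by auto
  then show "hyers_ulam_stable A"
    unfolding hyers_ulam_stable_def by blast
qed

section \<open>Eigenvalues\<close>

text \<open>The eigenvalue equation is transported along \<open>P\<close>, where it is a triangular system of two equations.\<close>

lemma eigenvalue_similar_lower_triangular:
  fixes A :: "real ^ 2 ^ 2" and P Q T :: "complex ^ 2 ^ 2"
  assumes PM: "P ** complexify A = T ** P" and PQ: "P ** Q = mat 1" and T: "T $ 1 $ 2 = 0"
  shows "eigenvalue A z \<longleftrightarrow> z = T $ 1 $ 1 \<or> z = T $ 2 $ 2"
proof -
  have QP: "Q ** P = mat 1"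
    using PQ matrix_left_right_inverse by blast
  have QT: "complexify A ** Q = Q ** T"
    using similar_inverse[OF PM PQ] by simp
  have "eigenvalue A z \<longleftrightarrow> (\<exists>w. w \<noteq> 0 \<and> T *v w = z *s w)"
  proof
    assume "eigenvalue A z"
    then obtain v where v: "v \<noteq> 0" "complexify A *v v = z *s v"
      unfolding eigenvalue_def by blast
    have "Q *v (P *v v) = v"
      by (simp add: matrix_vector_mul_assoc QP)
    then have "P *v v \<noteq> 0"
      using v(1) by (metis matrix_vector_mult_0_right)
    moreover have "T *v (P *v v) = z *s (P *v v)"
      by (simp add: matrix_vector_mul_assoc flip: PM) (simp add: v(2) vector_scalar_commute flip: matrix_vector_mul_assoc)
    ultimately show "\<exists>w. w \<noteq> 0 \<and> T *v w = z *s w" by blast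
  next
    assume "\<exists>w. w \<noteq> 0 \<and> T *v w = z *s w"
    then obtain w where w: "w \<noteq> 0" "T *v w = z *s w"
      by blast
    have "P *v (Q *v w) = w"
      by (simp add: matrix_vector_mul_assoc PQ)
    then have "Q *v w \<noteq> 0"
      using w(1) by (metis matrix_vector_mult_0_right)
    moreover have "complexify A *v (Q *v w) = z *s (Q *v w)"
      by (simp add: matrix_vector_mul_assoc QT) (simp add: w(2) vector_scalar_commute flip: matrix_vector_mul_assoc)
    ultimately show "eigenvalue A z"
      unfolding eigenvalue_def by blast
  qed
  also have "\<dots> \<longleftrightarrow> (\<exists>w :: complex ^ 2. w \<noteq> 0 \<and> T $ 1 $ 1 * w $ 1 = z * w $ 1 \<and>
      T $ 2 $ 1 * w $ 1 + T $ 2 $ 2 * w $ 2 = z * w $ 2)"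
  proof -
    have "T *v w = z *s w \<longleftrightarrow> T $ 1 $ 1 * w $ 1 = z * w $ 1 \<and>
      T $ 2 $ 1 * w $ 1 + T $ 2 $ 2 * w $ 2 = z * w $ 2" for w
      unfolding vec_eq_iff forall_2 by (simp add: matrix_vector_mult_def sum_2 T)
    then show ?thesis by simp
  qed
  also have "\<dots> \<longleftrightarrow> z = T $ 1 $ 1 \<or> z = T $ 2 $ 2" (is "?l \<longleftrightarrow> ?r")
  proof
    show ?r if ?l
      using that by (auto simp: vec_eq_iff forall_2)
    have "?l" if "z = T $ 2 $ 2"
      using that by (intro exI[of _ "vector [0, 1]"]) (auto simp: vec_eq_iff forall_2)
    \<comment> \<open>If both diagonal entries agree, the second basis vector of the previous case serves for both.\<close>
    moreover have "?l" if "z = T $ 1 $ 1" "z \<noteq> T $ 2 $ 2"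
      using that by (intro exI[of _ "vector [T $ 1 $ 1 - T $ 2 $ 2, T $ 2 $ 1]"])
        (auto simp: vec_eq_iff forall_2 algebra_simps)
    ultimately show ?l if ?r
      using that by blast
  qed
  finally show ?thesis .
qed

abbreviation hyperbolic :: "real ^ 'n ^ 'n \<Rightarrow> bool" where
  "hyperbolic A \<equiv> \<forall>z. eigenvalue A z \<longrightarrow> Re z \<noteq> 0"

theorem hyers_ulam_stable_iff_hyperbolic:
  fixes A :: "real ^ 2 ^ 2"
  shows "hyers_ulam_stable A \<longleftrightarrow> hyperbolic A"
proof -
  obtain T P Q :: "complex ^ 2 ^ 2" where
    PM: "P ** complexify A = T ** P" and PQ: "P ** Q = mat 1" and T: "T $ 1 $ 2 = 0"
    by (rule complex_2x2_schur)
  have QT: "Q ** T = complexify A ** Q" "Q ** P = mat 1"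
    using similar_inverse[OF PM PQ] PQ matrix_left_right_inverse by blast+
  have "hyers_ulam_stable A \<longleftrightarrow> shadowing T"
    unfolding hyers_ulam_stable_iff_shadowing
    using shadowing_transform[OF PM PQ] shadowing_transform[OF QT] by blast
  also have "\<dots> \<longleftrightarrow> Re (T $ 1 $ 1) \<noteq> 0 \<and> Re (T $ 2 $ 2) \<noteq> 0"
    using shadowing_lower_triangular_if[OF T] shadowing_lower_triangular_only_if[OF T] by blast
  also have "\<dots> \<longleftrightarrow> hyperbolic A"
    unfolding eigenvalue_similar_lower_triangular[OF PM PQ T] by blast
  finally show ?thesis .
qed

lemma hyperbolic_bounded_solution_zero:
  fixes A :: "real ^ 2 ^ 2"
  assumes "hyperbolic A" "driven A (\<lambda>_. 0) x" "\<And>t. infnorm (x t) \<le> B"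
  shows "x t = 0"
proof -
  obtain T P Q :: "complex ^ 2 ^ 2" where
    PM: "P ** complexify A = T ** P" and PQ: "P ** Q = mat 1" and T: "T $ 1 $ 2 = 0"
    by (rule complex_2x2_schur)
  have re: "Re (T $ 1 $ 1) \<noteq> 0" "Re (T $ 2 $ 2) \<noteq> 0"
    using assms(1) unfolding eigenvalue_similar_lower_triangular[OF PM PQ T] by blast+
  obtain D where D: "D > 0" "\<And>x. norm (P *v x) \<le> D * norm x"
    using matrix_vector_norm_bound[of P] by blast
  have "driven T (\<lambda>t. P *v of_real_vec 0) (\<lambda>t. P *v of_real_vec (x t))"
    using driven_transform[OF PM driven_of_real_vec[OF assms(2)]] .
  moreover have "of_real_vec 0 = (0 :: complex ^ 2)"
    by (simp add: of_real_vec_def vec_eq_iff)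
  ultimately have drv: "driven T (\<lambda>_. 0) (\<lambda>t. P *v of_real_vec (x t))"
    by simp
  have bnd: "norm (P *v of_real_vec (x t)) \<le> D * (2 * B)" for t
  proof -
    have "norm (of_real_vec (x t)) \<le> 2 * B"
      using norm_le_infnorm_parts[of "of_real_vec (x t)" B 0] assms(3)[of t] by (simp add: infnorm_0)
    then show ?thesis
      using D by (meson less_imp_le mult_left_mono order_trans)
  qed
  have "P *v of_real_vec (x t) = 0"
    by (rule bounded_solution_lower_triangular[OF T re drv bnd])
  then have "Q *v (P *v of_real_vec (x t)) = 0"
    by simp
  then have "of_real_vec (x t) = 0"
    using PQ matrix_left_right_inverse[of P Q] by (simp add: matrix_vector_mul_assoc)
  then show ?thesis
    by (metis re_im_of_real_vec(1,3))
qed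

lemma hyperbolic_imp_invertible:
  fixes A :: "real ^ 'n ^ 'n"
  assumes "hyperbolic A"
  shows "invertible A"
proof (rule ccontr)
  assume "\<not> invertible A"
  then obtain x where x: "x \<noteq> 0" "A *v x = 0"
    using matrix_left_invertible_ker[of A] invertible_left_inverse by blast
  have "complexify A *v of_real_vec x = of_real_vec (A *v x)"
    by (simp add: of_real_vec_def matrix_vector_mult_def vec_eq_iff)
  then have "complexify A *v of_real_vec x = 0 *s of_real_vec x"
    by (simp add: x(2) of_real_vec_def vec_eq_iff)
  moreover have "of_real_vec x \<noteq> 0"
    using x(1) by (metis re_im_of_real_vec(1,3))
  ultimately have "eigenvalue A 0"
    unfolding eigenvalue_def by blast
  with assms show False by force
qed

section \<open>The lower bound\<close>

lemma matrix_inv_inverse: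
  fixes A :: "'a::semiring_1 ^ 'n ^ 'm"
  assumes "invertible A"
  shows "A ** matrix_inv A = mat 1" "matrix_inv A ** A = mat 1"
  using someI_ex[OF assms[unfolded invertible_def]] by (simp_all add: matrix_inv_def)

text \<open>The forcing \<open>s\<close>, constant and of norm at most one, has the equilibrium \<open>v\<close>. The solution that shadows \<open>v\<close>
can only be zero, so every component of \<open>v\<close> is at most \<open>K\<close>; the \<open>i\<close>-th one is, up to sign, the absolute row
sum, because \<open>s\<close> carries the signs of row \<open>i\<close>.\<close>

lemma inverse_norm_le_hus_constant:
  fixes A :: "real ^ 'n ^ 'n"
  assumes inv: "invertible A" and K: "hus_constant A K"
    and zero: "\<And>x B t. driven A (\<lambda>_. 0) x \<Longrightarrow> (\<And>t. infnorm (x t) \<le> B) \<Longrightarrow> x t = 0"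
  shows "matrix_infnorm (matrix_inv A) \<le> K"
proof -
  have row: "(\<Sum>j\<in>UNIV. \<bar>matrix_inv A $ i $ j\<bar>) \<le> K" for i
  proof -
    define s :: "real ^ 'n" where "s = (\<chi> j. sgn (matrix_inv A $ i $ j))"
    define v where "v = matrix_inv A *v (- s)"
    have "A *v v + s = 0"
      by (simp add: v_def matrix_vector_mul_assoc matrix_inv_inverse(1)[OF inv])
    then have "driven A (\<lambda>_. s) (\<lambda>_. v)"
      by (simp add: driven_def)
    moreover have "infnorm s \<le> 1"
      by (simp add: infnorm_le_iff s_def abs_sgn_eq)
    ultimately obtain x where x: "driven A (\<lambda>_. 0) x" "\<And>t. infnorm (v - x t) \<le> K"
      using K unfolding hus_constant_iff_driven
      by (metis mult.right_neutral zero_less_one)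
    have "infnorm (x t) \<le> infnorm v + K" for t
      using infnorm_triangle[of v "x t - v"] x(2)[of t] by (simp add: infnorm_sub)
    then have "x 0 = 0"
      by (rule zero[OF x(1)])
    then have "\<bar>v $ i\<bar> \<le> K"
      using x(2)[of 0] by (simp add: infnorm_le_iff)
    moreover have "v $ i = - (\<Sum>j\<in>UNIV. \<bar>matrix_inv A $ i $ j\<bar>)"
      by (simp add: v_def s_def matrix_vector_mult_def abs_sgn sum_negf)
    ultimately show ?thesis
      by simp
  qed
  then show ?thesis
    unfolding matrix_infnorm_def by (intro Max.boundedI) auto
qed

section \<open>The sharp upper bound\<close>

text \<open>Here \<open>e r\<close> is row \<open>i\<close> of \<open>exp (A r)\<close>, and \<open>B\<close> is the inverse of \<open>A\<close>. For fixed \<open>t\<close>, the function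
\<open>h s = e (t - s) \<bullet> w s\<close> leads from \<open>w t $ i\<close> at \<open>s = t\<close> to zero at infinity, and the terms with \<open>A\<close> cancel in
its derivative \<open>e (t - s) \<bullet> q s\<close>. As the entries of \<open>e\<close> have the fixed signs \<open>\<sigma>\<close>, its absolute value is at most
\<open>\<epsilon> (e (t - s) \<bullet> \<sigma>)\<close>, the derivative of the function \<open>G\<close> below. The total change of \<open>G\<close>
is \<open>\<epsilon>\<close> times row \<open>i\<close> of \<open>B\<close> applied to \<open>\<sigma>\<close>.\<close>

lemma bounded_response_le:
  fixes A B :: "real ^ 'n ^ 'n" and e w :: "real \<Rightarrow> real ^ 'n"
  assumes AB: "A ** B = mat 1"
    and e': "\<And>r. (e has_vector_derivative e r v* A) (at r)"
    and e0: "e 0 = axis i 1"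
    and lim: "(e \<longlongrightarrow> 0) at_bot"
    and sgn: "\<And>j. (\<forall>r\<le>0. 0 \<le> e r $ j) \<or> (\<forall>r\<le>0. e r $ j \<le> 0)"
    and w: "driven A q w" and q: "\<And>t. infnorm (q t) \<le> \<epsilon>"
    and bnd: "\<And>t. norm (w t) \<le> W"
  shows "\<bar>w t $ i\<bar> \<le> (\<Sum>j\<in>UNIV. \<bar>B $ i $ j\<bar>) * \<epsilon>"
proof -
  have \<epsilon>: "\<epsilon> \<ge> 0"
    using q[of 0] infnorm_pos_le[of "q 0"] by linarith
  define \<sigma> :: "real ^ 'n" where "\<sigma> = (\<chi> j. if \<forall>r\<le>0. 0 \<le> e r $ j then 1 else - 1)"
  have \<sigma>e: "e r $ j * \<sigma> $ j = \<bar>e r $ j\<bar>" if "r \<le> 0" for r j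
  proof (cases "\<forall>r\<le>0. 0 \<le> e r $ j")
    case True
    then have "\<sigma> $ j = 1" "0 \<le> e r $ j"
      using that unfolding \<sigma>_def by simp_all
    then show ?thesis by simp
  next
    case False
    then have "\<sigma> $ j = - 1" "e r $ j \<le> 0"
      using that sgn[of j] unfolding \<sigma>_def by (simp, blast)
    then show ?thesis by simp
  qed
  define h where "h = (\<lambda>s. inner (e (t - s)) (w s))"
  define G where "G = (\<lambda>s. - \<epsilon> * inner (e (t - s)) (B *v \<sigma>))"
  have de: "((\<lambda>s. e (t - s)) has_vector_derivative - (e (t - s) v* A)) (at s)" for s
  proof -
    have "((\<lambda>s. t - s) has_vector_derivative -1) (at s)"
      by (auto intro!: derivative_eq_intros)
    from vector_diff_chain_at[OF this e'] show ?thesis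
      by (simp add: o_def)
  qed
  have dw: "(w has_vector_derivative A *v w s + q s) (at s)" for s
    using w by (simp add: driven_def)
  have dh: "(h has_vector_derivative inner (e (t - s)) (q s)) (at s)" for s
    unfolding h_def
    by (rule has_vector_derivative_eq_rhs
        [OF bounded_bilinear.has_vector_derivative[OF bounded_bilinear_inner de dw]])
       (simp add: inner_add_right dot_lmul_matrix)
  have "((\<lambda>s. inner (e (t - s)) (B *v \<sigma>)) has_vector_derivative
      - (inner (e (t - s)) (A *v (B *v \<sigma>)))) (at s)" for s
    by (rule has_vector_derivative_eq_rhs
        [OF bounded_linear.has_vector_derivative[OF bounded_linear_inner_left de]])
       (simp add: dot_lmul_matrix)
  from bounded_linear.has_vector_derivative[OF bounded_linear_mult_right this, of "- \<epsilon>"]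
  have dG: "(G has_vector_derivative \<epsilon> * inner (e (t - s)) \<sigma>) (at s)" for s
    by (simp add: G_def matrix_vector_mul_assoc AB)
  have speed: "norm (inner (e (t - s)) (q s)) \<le> \<epsilon> * inner (e (t - s)) \<sigma>" if "s \<ge> t" for s
  proof -
    have "norm (inner (e (t - s)) (q s)) \<le> (\<Sum>j\<in>UNIV. \<bar>e (t - s) $ j * q s $ j\<bar>)"
      by (simp add: inner_vec_def)
    also have "\<dots> \<le> (\<Sum>j\<in>UNIV. \<epsilon> * (e (t - s) $ j * \<sigma> $ j))"
    proof (rule sum_mono)
      fix j
      have "\<bar>q s $ j\<bar> \<le> \<epsilon>"
        using q[of s] by (simp add: infnorm_le_iff)
      then show "\<bar>e (t - s) $ j * q s $ j\<bar> \<le> \<epsilon> * (e (t - s) $ j * \<sigma> $ j)"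
        using that by (simp add: \<sigma>e abs_mult mult.commute[of \<epsilon>] mult_left_mono)
    qed
    also have "\<dots> = \<epsilon> * inner (e (t - s)) \<sigma>"
      by (simp add: inner_vec_def sum_distrib_left)
    finally show ?thesis .
  qed
  have le: "norm (h s - h t) \<le> G s - G t" if "s > t" for s
  proof (rule differentiable_bound_general[OF that])
    show "continuous_on {t..s} h" "continuous_on {t..s} G"
      by (meson continuous_at_imp_continuous_on dh dG has_vector_derivative_continuous)+
    show "(h has_vector_derivative inner (e (t - x)) (q x)) (at x)"
      "(G has_vector_derivative \<epsilon> * inner (e (t - x)) \<sigma>) (at x)" for x
      by (rule dh dG)+
    show "norm (inner (e (t - x)) (q x)) \<le> \<epsilon> * inner (e (t - x)) \<sigma>" if "t < x" for x
      using that by (intro speed) simp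
  qed
  have shift: "filterlim (\<lambda>s. t - s) at_bot at_top"
    unfolding filterlim_at_bot
  proof
    fix Z
    show "\<forall>\<^sub>F s in at_top. t - s \<le> Z"
      using eventually_ge_at_top[of "t - Z"] by eventually_elim simp
  qed
  have lim_e: "((\<lambda>s. e (t - s)) \<longlongrightarrow> 0) at_top"
    by (rule filterlim_compose[OF lim shift])
  have lim_G: "(G \<longlongrightarrow> - \<epsilon> * inner 0 (B *v \<sigma>)) at_top"
    unfolding G_def by (intro tendsto_intros lim_e)
  have lim_h: "(h \<longlongrightarrow> 0) at_top"
  proof (rule Lim_null_comparison)
    show "\<forall>\<^sub>F s in at_top. norm (h s) \<le> norm (e (t - s)) * W"
      unfolding h_def real_norm_def
      by (intro always_eventually allI order_trans[OF Cauchy_Schwarz_ineq2] mult_left_mono bnd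
          norm_ge_zero)
    show "((\<lambda>s. norm (e (t - s)) * W) \<longlongrightarrow> 0) at_top"
      using tendsto_mult[OF tendsto_norm[OF lim_e] tendsto_const[of W]] by simp
  qed
  have "norm (0 - h t) \<le> - \<epsilon> * inner 0 (B *v \<sigma>) - G t"
  proof (rule tendsto_le)
    show "\<forall>\<^sub>F s in at_top. norm (h s - h t) \<le> G s - G t"
      using eventually_gt_at_top[of t] by eventually_elim (rule le)
  qed (intro tendsto_intros lim_h lim_G trivial_limit_at_top_linorder)+
  then have "\<bar>w t $ i\<bar> \<le> \<epsilon> * (B *v \<sigma>) $ i"
    by (simp add: h_def G_def e0 inner_axis')
  also have "\<dots> \<le> \<epsilon> * (\<Sum>j\<in>UNIV. \<bar>B $ i $ j\<bar>)"
  proof (rule mult_left_mono[OF _ \<epsilon>])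
    have "B $ i $ j * \<sigma> $ j \<le> \<bar>B $ i $ j\<bar>" for j
    proof -
      have "\<sigma> $ j = 1 \<or> \<sigma> $ j = - 1"
        unfolding \<sigma>_def vec_lambda_beta by presburger
      then show ?thesis by auto
    qed
    then show "(B *v \<sigma>) $ i \<le> (\<Sum>j\<in>UNIV. \<bar>B $ i $ j\<bar>)"
      unfolding matrix_vector_mult_def vec_lambda_beta by (rule sum_mono)
  qed
  finally show ?thesis
    by (simp add: mult.commute)
qed

lemma row_sum_le_matrix_infnorm:
  fixes M :: "real ^ 'n ^ 'm"
  shows "(\<Sum>j\<in>UNIV. \<bar>M $ i $ j\<bar>) \<le> matrix_infnorm M"
  unfolding matrix_infnorm_def by (rule Max_ge) auto

lemma matrix_infnorm_pos:
  fixes M :: "real ^ 'n ^ 'm"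
  assumes "M \<noteq> 0"
  shows "matrix_infnorm M > 0"
proof -
  obtain i j where "M $ i $ j \<noteq> 0"
    using assms by (auto simp: vec_eq_iff)
  then have "0 < (\<Sum>j\<in>UNIV. \<bar>M $ i $ j\<bar>)"
    by (intro sum_pos2[of UNIV j]) auto
  then show ?thesis
    using row_sum_le_matrix_infnorm[of M i] by linarith
qed

lemma matrix_inv_nonzero:
  fixes A :: "real ^ 'n ^ 'n"
  assumes "invertible A"
  shows "matrix_inv A \<noteq> 0"
proof
  assume "matrix_inv A = 0"
  then have "A *v (matrix_inv A *v axis undefined 1) = 0"
    by simp
  then have "axis undefined (1::real) = (0 :: real ^ 'n)"
    by (simp add: matrix_vector_mul_assoc matrix_inv_inverse(1)[OF assms])
  then show False
    by (simp add: axis_eq_0_iff)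
qed

text \<open>Stability with some constant supplies a solution at bounded distance; the bound on that distance is
then improved to the optimal one by \<open>bounded_response_le\<close>, one row of the exponential \<open>E\<close> at a time. The
limit at \<open>- \<infinity>\<close> says that the system is expanding.\<close>

lemma hus_constant_inverse_norm:
  fixes A :: "real ^ 'n ^ 'n" and E :: "real \<Rightarrow> real ^ 'n ^ 'n"
  assumes inv: "invertible A" and stable: "hyers_ulam_stable A"
    and E': "\<And>r. (E has_vector_derivative E r ** A) (at r)"
    and E0: "E 0 = mat 1" and lim: "(E \<longlongrightarrow> 0) at_bot"
    and sgn: "\<And>i j. (\<forall>r\<le>0. 0 \<le> E r $ i $ j) \<or> (\<forall>r\<le>0. E r $ i $ j \<le> 0)"
  shows "hus_constant A (matrix_infnorm (matrix_inv A))"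
  unfolding hus_constant_iff_driven
proof (intro conjI allI impI)
  show "matrix_infnorm (matrix_inv A) > 0"
    by (intro matrix_infnorm_pos matrix_inv_nonzero inv)
next
  fix \<epsilon> :: real and \<phi> q assume \<epsilon>: "\<epsilon> > 0" and \<phi>: "driven A q \<phi>" and q: "\<forall>t. infnorm (q t) \<le> \<epsilon>"
  obtain K x where x: "driven A (\<lambda>_. 0) x" "\<And>t. infnorm (\<phi> t - x t) \<le> K * \<epsilon>"
    using stable \<epsilon> \<phi> q unfolding hyers_ulam_stable_def hus_constant_iff_driven by meson
  define w where "w = (\<lambda>t. \<phi> t - x t)"
  have "(w has_vector_derivative A *v w t + q t) (at t)" for t
  proof -
    have "(\<phi> has_vector_derivative A *v \<phi> t + q t) (at t)" "(x has_vector_derivative A *v x t) (at t)"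
      using \<phi> x(1) by (simp_all add: driven_def)
    from has_vector_derivative_diff[OF this] show ?thesis
      by (simp add: w_def algebra_simps)
  qed
  then have w: "driven A q w"
    by (simp add: driven_def)
  have bnd: "norm (w t) \<le> sqrt DIM(real ^ 'n) * (K * \<epsilon>)" for t
    unfolding w_def by (intro order_trans[OF norm_le_infnorm] mult_left_mono x(2)) simp
  have "infnorm (w t) \<le> matrix_infnorm (matrix_inv A) * \<epsilon>" for t
    unfolding infnorm_le_iff
  proof
    fix i
    have row: "(E r ** A) $ i = E r $ i v* A" for r
      by (simp add: vec_eq_iff matrix_matrix_mult_def vector_matrix_mult_def mult.commute)
    have "\<bar>w t $ i\<bar> \<le> (\<Sum>j\<in>UNIV. \<bar>matrix_inv A $ i $ j\<bar>) * \<epsilon>"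
    proof (rule bounded_response_le[where e = "\<lambda>r. E r $ i", OF matrix_inv_inverse(1)[OF inv] _ _ _ _ w _ bnd])
      show "((\<lambda>r. E r $ i) has_vector_derivative E r $ i v* A) (at r)" for r
        using E'[of r] unfolding has_vector_derivative_vec_iff[of E] row[symmetric] by blast
      show "E 0 $ i = axis i 1"
        by (simp add: E0 vec_eq_iff mat_def axis_def)
      show "((\<lambda>r. E r $ i) \<longlongrightarrow> 0) at_bot"
        using tendsto_vec_nth[OF lim, of i] by simp
    qed (use sgn q in auto)
    also have "\<dots> \<le> matrix_infnorm (matrix_inv A) * \<epsilon>"
      using \<epsilon> by (intro mult_right_mono row_sum_le_matrix_infnorm) auto
    finally show "\<bar>w t $ i\<bar> \<le> matrix_infnorm (matrix_inv A) * \<epsilon>" .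
  qed
  then show "\<exists>x. driven A (\<lambda>_. 0) x \<and> (\<forall>t. infnorm (\<phi> t - x t) \<le> matrix_infnorm (matrix_inv A) * \<epsilon>)"
    using x(1) unfolding w_def by blast
qed

section \<open>Time reversal\<close>

lemma driven_reflect:
  fixes A :: "real ^ 'n ^ 'n"
  assumes "driven A q x"
  shows "driven (- A) (\<lambda>t. - q (- t)) (\<lambda>t. x (- t))"
  unfolding driven_def
proof
  fix t
  have "(x has_vector_derivative A *v x (- t) + q (- t)) (at (- t))"
    using assms by (simp add: driven_def)
  moreover have "(- A) *v x (- t) = - (A *v x (- t))"
    by (simp add: vec_eq_iff matrix_vector_mult_def sum_negf)
  ultimately show "((\<lambda>t. x (- t)) has_vector_derivative (- A) *v x (- t) + - q (- t)) (at t)"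
    using has_vector_derivative_reflect by fastforce
qed

lemma hus_constant_reflect:
  fixes A :: "real ^ 'n ^ 'n"
  assumes "hus_constant (- A) K"
  shows "hus_constant A K"
  unfolding hus_constant_iff_driven
proof (intro conjI allI impI)
  show "K > 0"
    using assms by (simp add: hus_constant_def)
next
  fix \<epsilon> :: real and \<phi> q assume "\<epsilon> > 0" "driven A q \<phi>" and q: "\<forall>t. infnorm (q t) \<le> \<epsilon>"
  then obtain x where x: "driven (- A) (\<lambda>_. 0) x" "\<And>t. infnorm (\<phi> (- t) - x t) \<le> K * \<epsilon>"
    using assms driven_reflect[of A q \<phi>] unfolding hus_constant_iff_driven
    by (metis (no_types, lifting) infnorm_neg)
  have "driven A (\<lambda>_. 0) (\<lambda>t. x (- t))"
    using driven_reflect[OF x(1)] by simp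
  moreover have "infnorm (\<phi> t - x (- t)) \<le> K * \<epsilon>" for t
    using x(2)[of "- t"] by simp
  ultimately show "\<exists>x. driven A (\<lambda>_. 0) x \<and> (\<forall>t. infnorm (\<phi> t - x t) \<le> K * \<epsilon>)"
    by (intro exI[of _ "\<lambda>t. x (- t)"]) blast
qed

lemma matrix_mul_minus:
  fixes A B :: "'a::ring_1 ^ 'n ^ 'n"
  shows "(- A) ** (- B) = A ** B"
  by (simp add: vec_eq_iff matrix_matrix_mult_def)

lemma matrix_inv_minus:
  fixes A :: "real ^ 'n ^ 'n"
  assumes "invertible A"
  shows "invertible (- A)" "matrix_inv (- A) = - matrix_inv A"
proof -
  have inv: "(- A) ** (- matrix_inv A) = mat 1" "(- matrix_inv A) ** (- A) = mat 1"
    unfolding matrix_mul_minus using matrix_inv_inverse[OF assms] by blast+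
  then show *: "invertible (- A)"
    unfolding invertible_def by blast
  have "matrix_inv (- A) = matrix_inv (- A) ** ((- A) ** (- matrix_inv A))"
    by (simp add: inv)
  also have "\<dots> = - matrix_inv A"
    by (simp add: matrix_mul_assoc matrix_inv_inverse(2)[OF *])
  finally show "matrix_inv (- A) = - matrix_inv A" .
qed

lemma matrix_infnorm_minus [simp]: "matrix_infnorm (- M) = matrix_infnorm M"
  by (simp add: matrix_infnorm_def)

section \<open>Planar systems whose exponential keeps its signs\<close>

text \<open>By Cramer's rule the characteristic polynomial at \<open>z\<close> annihilates both entries of an eigenvector, one of
which is nonzero.\<close>

lemma eigenvalue_characteristic_equation:
  fixes A :: "real ^ 2 ^ 2"
  assumes "eigenvalue A z"
  shows "z\<^sup>2 - of_real (A $ 1 $ 1 + A $ 2 $ 2) * z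
    + of_real (A $ 1 $ 1 * A $ 2 $ 2 - A $ 1 $ 2 * A $ 2 $ 1) = 0"
proof -
  define a b c d where "a = complex_of_real (A $ 1 $ 1)" and "b = complex_of_real (A $ 1 $ 2)"
    and "c = complex_of_real (A $ 2 $ 1)" and "d = complex_of_real (A $ 2 $ 2)"
  obtain v where v: "v \<noteq> 0" "complexify A *v v = z *s v"
    using assms unfolding eigenvalue_def by blast
  have "(complexify A *v v) $ i = (z *s v) $ i" for i
    by (simp only: v(2))
  from this[of 1] this[of 2]
  have "a * v $ 1 + b * v $ 2 = z * v $ 1" "c * v $ 1 + d * v $ 2 = z * v $ 2"
    by (simp_all add: matrix_vector_mult_def sum_2 a_def b_def c_def d_def)
  then have "(z\<^sup>2 - (a + d) * z + (a * d - b * c)) * v $ 1 = 0"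
    "(z\<^sup>2 - (a + d) * z + (a * d - b * c)) * v $ 2 = 0"
    by algebra+
  moreover have "v $ 1 \<noteq> 0 \<or> v $ 2 \<noteq> 0"
    using v(1) by (simp add: vec_eq_iff forall_2)
  ultimately show ?thesis
    by (auto simp: a_def b_def c_def d_def)
qed

lemma hyperbolic_of_real_roots:
  fixes A :: "real ^ 2 ^ 2"
  assumes "A $ 1 $ 1 + A $ 2 $ 2 = l1 + l2" "A $ 1 $ 1 * A $ 2 $ 2 - A $ 1 $ 2 * A $ 2 $ 1 = l1 * l2"
    and "l1 * l2 \<noteq> 0"
  shows "hyperbolic A"
proof (intro allI impI)
  fix z assume "eigenvalue A z"
  from eigenvalue_characteristic_equation[OF this, unfolded assms(1,2)]
  have "(z - of_real l1) * (z - of_real l2) = 0"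
    by (simp add: algebra_simps power2_eq_square)
  then show "Re z \<noteq> 0"
    using assms(3) by auto
qed

text \<open>By the Cayley-Hamilton theorem \<open>exp (A r)\<close> is \<open>\<alpha> r + \<beta> r A\<close> for scalar functions \<open>\<alpha>\<close> and \<open>\<beta>\<close>; the two
differential equations below are what \<open>A\<^sup>2 = (tr A) A - det A\<close> makes of \<open>E' = E A\<close>. The off-diagonal entries are
multiples of \<open>\<beta>\<close>, so that only the diagonal ones need a sign condition of their own.\<close>

lemma hus_constant_planar:
  fixes A :: "real ^ 2 ^ 2" and \<alpha> \<beta> :: "real \<Rightarrow> real"
  assumes hyp: "hyperbolic A"
    and \<alpha>': "\<And>r. (\<alpha> has_real_derivative - (A $ 1 $ 1 * A $ 2 $ 2 - A $ 1 $ 2 * A $ 2 $ 1) * \<beta> r) (at r)"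
    and \<beta>': "\<And>r. (\<beta> has_real_derivative \<alpha> r + (A $ 1 $ 1 + A $ 2 $ 2) * \<beta> r) (at r)"
    and init: "\<alpha> 0 = 1" "\<beta> 0 = 0"
    and lim: "(\<alpha> \<longlongrightarrow> 0) at_bot" "(\<beta> \<longlongrightarrow> 0) at_bot"
    and sgn: "\<And>r. r \<le> 0 \<Longrightarrow> \<beta> r \<le> 0" "\<And>i r. r \<le> 0 \<Longrightarrow> 0 \<le> \<alpha> r + A $ i $ i * \<beta> r"
  shows "hus_constant A (matrix_infnorm (matrix_inv A))"
proof (rule hus_constant_inverse_norm)
  let ?E = "\<lambda>r. \<alpha> r *\<^sub>R mat 1 + \<beta> r *\<^sub>R A"
  show "invertible A" "hyers_ulam_stable A"
    using hyp hyperbolic_imp_invertible hyers_ulam_stable_iff_hyperbolic by blast+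
  show "(?E has_vector_derivative ?E r ** A) (at r)" for r
  proof -
    have "(?E has_vector_derivative
        (- (A $ 1 $ 1 * A $ 2 $ 2 - A $ 1 $ 2 * A $ 2 $ 1) * \<beta> r) *\<^sub>R mat 1
        + (\<alpha> r + (A $ 1 $ 1 + A $ 2 $ 2) * \<beta> r) *\<^sub>R A) (at r)"
      by (rule derivative_eq_intros \<alpha>' \<beta>' refl | simp)+
    also have "(- (A $ 1 $ 1 * A $ 2 $ 2 - A $ 1 $ 2 * A $ 2 $ 1) * \<beta> r) *\<^sub>R mat 1
        + (\<alpha> r + (A $ 1 $ 1 + A $ 2 $ 2) * \<beta> r) *\<^sub>R A = ?E r ** A"
      by (simp add: vec_eq_iff forall_2 matrix_matrix_mult_def sum_2 mat_def algebra_simps)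
    finally show ?thesis .
  qed
  show "?E 0 = mat 1"
    by (simp add: init)
  have "(?E \<longlongrightarrow> 0 *\<^sub>R mat 1 + 0 *\<^sub>R A) at_bot"
    by (intro tendsto_intros lim)
  then show "(?E \<longlongrightarrow> 0) at_bot"
    by simp
  show "(\<forall>r\<le>0. 0 \<le> ?E r $ i $ j) \<or> (\<forall>r\<le>0. ?E r $ i $ j \<le> 0)" for i j
  proof (cases "i = j")
    case True
    then show ?thesis
      using sgn(2)[of _ i] by (simp add: mat_def mult.commute)
  next
    case False
    then have entry: "?E r $ i $ j = \<beta> r * A $ i $ j" for r
      by (simp add: mat_def)
    show ?thesis
      unfolding entry using sgn(1)
      by (cases "A $ i $ j \<ge> 0") (auto simp: mult_nonpos_nonneg mult_nonpos_nonpos)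
  qed
qed

text \<open>The functions \<open>\<alpha>\<close> and \<open>\<beta>\<close> come from the interpolation of \<open>exp\<close> at the two eigenvalues. For a diagonal
entry \<open>s\<close> of \<open>A\<close>, the entry of the exponential is the combination of \<open>exp (l2 r)\<close> and \<open>exp (l1 r)\<close> with weights
proportional to \<open>l1 - s\<close> and \<open>s - l2\<close>, and this is where the position of \<open>a\<close> enters; by the trace, the other
diagonal entry lies between the eigenvalues as well.\<close>

lemma hus_constant_distinct_positive:
  fixes A :: "real ^ 2 ^ 2"
  assumes tr: "A $ 1 $ 1 + A $ 2 $ 2 = l1 + l2"
    and det: "A $ 1 $ 1 * A $ 2 $ 2 - A $ 1 $ 2 * A $ 2 $ 1 = l1 * l2"
    and l: "l1 > l2" "l2 > 0" and between: "l1 \<ge> A $ 1 $ 1" "A $ 1 $ 1 \<ge> l2"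
  shows "hus_constant A (matrix_infnorm (matrix_inv A))"
proof -
  define \<alpha> \<beta> where "\<alpha> = (\<lambda>r. (l1 * exp (l2 * r) - l2 * exp (l1 * r)) / (l1 - l2))"
    and "\<beta> = (\<lambda>r. (exp (l1 * r) - exp (l2 * r)) / (l1 - l2))"
  show ?thesis
  proof (rule hus_constant_planar)
    show "hyperbolic A"
      using hyperbolic_of_real_roots[OF tr det] l by simp
    show "(\<alpha> has_real_derivative - (A $ 1 $ 1 * A $ 2 $ 2 - A $ 1 $ 2 * A $ 2 $ 1) * \<beta> r) (at r)" for r
      unfolding det \<alpha>_def \<beta>_def using l
      by (auto intro!: derivative_eq_intros) (simp add: field_simps)
    show "(\<beta> has_real_derivative \<alpha> r + (A $ 1 $ 1 + A $ 2 $ 2) * \<beta> r) (at r)" for r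
    proof -
      have "(\<beta> has_real_derivative (l1 * exp (l1 * r) - l2 * exp (l2 * r)) / (l1 - l2)) (at r)"
        unfolding \<beta>_def using l by (auto intro!: derivative_eq_intros)
      also have "(l1 * exp (l1 * r) - l2 * exp (l2 * r)) / (l1 - l2) = \<alpha> r + (l1 + l2) * \<beta> r"
        unfolding \<alpha>_def \<beta>_def times_divide_eq_right add_divide_distrib[symmetric]
        by (simp add: algebra_simps)
      finally show ?thesis
        unfolding tr .
    qed
    show "\<alpha> 0 = 1" "\<beta> 0 = 0"
      using l by (simp_all add: \<alpha>_def \<beta>_def)
    show "(\<alpha> \<longlongrightarrow> 0) at_bot" "(\<beta> \<longlongrightarrow> 0) at_bot"
      unfolding \<alpha>_def \<beta>_def using l by real_asymp+
    show "\<beta> r \<le> 0" if "r \<le> 0" for r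
      using l that by (auto simp: \<beta>_def divide_nonpos_pos mult_right_mono_neg)
    have "\<alpha> r + s * \<beta> r = ((l1 - s) * exp (l2 * r) + (s - l2) * exp (l1 * r)) / (l1 - l2)" for r s
      unfolding \<alpha>_def \<beta>_def times_divide_eq_right add_divide_distrib[symmetric]
      by (simp add: algebra_simps)
    moreover have "l2 \<le> A $ i $ i \<and> A $ i $ i \<le> l1" for i
      using between tr exhaust_2[of i] by auto
    ultimately show "0 \<le> \<alpha> r + A $ i $ i * \<beta> r" for i r
      using l by simp
  qed
qed

text \<open>These \<open>\<alpha>\<close> and \<open>\<beta>\<close> are the confluent form of those for distinct eigenvalues: they express
\<open>exp (A r) = exp (l r) (1 + r (A - l))\<close>.\<close>

lemma hus_constant_double_positive:
  fixes A :: "real ^ 2 ^ 2"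
  assumes A: "A $ 1 $ 1 = l" "A $ 2 $ 2 = l" "A $ 1 $ 2 * A $ 2 $ 1 = 0" and l: "l > 0"
  shows "hus_constant A (matrix_infnorm (matrix_inv A))"
proof -
  define \<alpha> \<beta> where "\<alpha> = (\<lambda>r. (1 - l * r) * exp (l * r))" and "\<beta> = (\<lambda>r. r * exp (l * r))"
  show ?thesis
  proof (rule hus_constant_planar)
    show "hyperbolic A"
      using hyperbolic_of_real_roots[of A l l] A l by simp
    show "(\<alpha> has_real_derivative - (A $ 1 $ 1 * A $ 2 $ 2 - A $ 1 $ 2 * A $ 2 $ 1) * \<beta> r) (at r)" for r
      unfolding A \<alpha>_def \<beta>_def
      by (auto intro!: derivative_eq_intros simp: algebra_simps)
    show "(\<beta> has_real_derivative \<alpha> r + (A $ 1 $ 1 + A $ 2 $ 2) * \<beta> r) (at r)" for r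
      unfolding A \<alpha>_def \<beta>_def
      by (auto intro!: derivative_eq_intros simp: algebra_simps)
    show "\<alpha> 0 = 1" "\<beta> 0 = 0"
      by (simp_all add: \<alpha>_def \<beta>_def)
    show "(\<alpha> \<longlongrightarrow> 0) at_bot" "(\<beta> \<longlongrightarrow> 0) at_bot"
      unfolding \<alpha>_def \<beta>_def using l by real_asymp+
    show "\<beta> r \<le> 0" if "r \<le> 0" for r
      using that by (simp add: \<beta>_def mult_nonpos_nonneg)
    show "0 \<le> \<alpha> r + A $ i $ i * \<beta> r" for i r
      using exhaust_2[of i] A by (auto simp: \<alpha>_def \<beta>_def algebra_simps)
  qed
qed

text \<open>Reversing time replaces \<open>A\<close> by \<open>- A\<close>, whose inverse has the same norm.\<close>

lemma hus_constant_from_reflected: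
  fixes A :: "real ^ 'n ^ 'n"
  assumes "invertible A" "hus_constant (- A) (matrix_infnorm (matrix_inv (- A)))"
  shows "hus_constant A (matrix_infnorm (matrix_inv A))"
  using hus_constant_reflect[OF assms(2)]
  by (simp only: matrix_inv_minus(2)[OF assms(1)] matrix_infnorm_minus)

lemma hus_constant_distinct:
  fixes A :: "real ^ 2 ^ 2"
  assumes tr: "A $ 1 $ 1 + A $ 2 $ 2 = l1 + l2"
    and det: "A $ 1 $ 1 * A $ 2 $ 2 - A $ 1 $ 2 * A $ 2 $ 1 = l1 * l2"
    and l: "l1 > l2" "l1 * l2 > 0" and between: "l1 \<ge> A $ 1 $ 1" "A $ 1 $ 1 \<ge> l2"
  shows "hus_constant A (matrix_infnorm (matrix_inv A))"
proof (cases "l2 > 0")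
  case True
  show ?thesis
    by (rule hus_constant_distinct_positive[OF tr det l(1) True between])
next
  case False
  then have neg: "l1 < 0" "l2 < 0"
    using l(2) by (auto simp: zero_less_mult_iff)
  have "hyperbolic A"
    by (rule hyperbolic_of_real_roots[OF tr det]) (use l(2) in linarith)
  moreover have "hus_constant (- A) (matrix_infnorm (matrix_inv (- A)))"
    by (rule hus_constant_distinct_positive[of _ "- l2" "- l1"])
       (use tr in simp, use det in simp, use l(1) in simp, use neg in simp, use between in simp_all)
  ultimately show ?thesis
    by (rule hus_constant_from_reflected[OF hyperbolic_imp_invertible])
qed

lemma hus_constant_double:
  fixes A :: "real ^ 2 ^ 2"
  assumes A: "A $ 1 $ 1 = l" "A $ 2 $ 2 = l" "A $ 1 $ 2 * A $ 2 $ 1 = 0" and l: "l \<noteq> 0"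
  shows "hus_constant A (matrix_infnorm (matrix_inv A))"
proof (cases "l > 0")
  case True
  then show ?thesis
    using hus_constant_double_positive[OF A] by simp
next
  case False
  have "hyperbolic A"
    using hyperbolic_of_real_roots[of A l l] A l by simp
  moreover have "hus_constant (- A) (matrix_infnorm (matrix_inv (- A)))"
    by (rule hus_constant_double_positive[of _ "- l"]) (use A l False in simp_all)
  ultimately show ?thesis
    by (rule hus_constant_from_reflected[OF hyperbolic_imp_invertible])
qed

lemma planar_inverse_norm_le:
  fixes A :: "real ^ 2 ^ 2"
  assumes "hus_constant A K"
  shows "matrix_infnorm (matrix_inv A) \<le> K"
proof (rule inverse_norm_le_hus_constant)
  have "hyperbolic A"
    using assms hyers_ulam_stable_iff_hyperbolic hyers_ulam_stable_def by blast
  then show "invertible A"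
    "\<And>x B t. driven A (\<lambda>_. 0) x \<Longrightarrow> (\<And>t. infnorm (x t) \<le> B) \<Longrightarrow> x t = 0"
    using hyperbolic_imp_invertible hyperbolic_bounded_solution_zero by blast+
qed (rule assms)

lemma planar_best_hus_constant:
  fixes A :: "real ^ 2 ^ 2"
  assumes "hus_constant A (matrix_infnorm (matrix_inv A))"
  shows "best_hus_constant A (matrix_infnorm (matrix_inv A))"
  using assms planar_inverse_norm_le by (simp add: best_hus_constant_def)

lemma charpoly_2:
  fixes A :: "real ^ 2 ^ 2"
  shows "charpoly A =
    [:A $ 1 $ 1 * A $ 2 $ 2 - A $ 1 $ 2 * A $ 2 $ 1, - (A $ 1 $ 1 + A $ 2 $ 2), 1:]"
  by (simp add: charpoly_def det_2 mat_def)

text \<open>A double root is a common root of the polynomial and its derivative.\<close>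

lemma double_root_monic_quadratic:
  fixes l p q :: real
  assumes "order l [:q, p, 1:] = 2"
  shows "p = - 2 * l" "q = l\<^sup>2"
proof -
  have "[:- l, 1:]\<^sup>2 dvd [:q, p, 1:]"
    using order_1[of l "[:q, p, 1:]"] assms by simp
  then obtain k where k: "[:q, p, 1:] = [:- l, 1:]\<^sup>2 * k"
    by blast
  have "poly [:q, p, 1:] l = 0" "poly (pderiv [:q, p, 1:]) l = 0"
    unfolding k power2_eq_square by (simp_all add: pderiv_mult pderiv_pCons del: mult_pCons_left)
  then have "q + l * (p + l) = 0" "p = - 2 * l"
    by (auto simp: pderiv_pCons)
  then show "p = - 2 * l" "q = l\<^sup>2"
    by (auto simp: algebra_simps power2_eq_square)
qed

theorem theorem4p3:
  fixes a b c d :: real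
    and A :: "real ^ 2 ^ 2"
  assumes "A = vector [vector [a, b], vector [c, d]]"
  shows
    "(hyers_ulam_stable A \<longleftrightarrow> (\<forall>z. eigenvalue A z \<longrightarrow> Re z \<noteq> 0))
   \<and> (hyers_ulam_stable A \<longrightarrow>
        (\<forall>K. hus_constant A K \<longrightarrow> matrix_infnorm (matrix_inv A) \<le> K))
   \<and> (\<exists>B :: real ^ 2 ^ 2. hyers_ulam_stable B
        \<and> best_hus_constant B (matrix_infnorm (matrix_inv B)))
   \<and> (\<forall>l1 l2 :: real.
        eigenvalue A (of_real l1) \<longrightarrow> eigenvalue A (of_real l2) \<longrightarrow>
        l1 > l2 \<longrightarrow> l1 * l2 > 0 \<longrightarrow> l1 \<ge> a \<longrightarrow> a \<ge> l2 \<longrightarrow>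
        best_hus_constant A (matrix_infnorm (matrix_inv A)))
   \<and> (\<forall>l :: real.
        order l (charpoly A) = 2 \<longrightarrow> l \<noteq> 0 \<longrightarrow> l = a \<longrightarrow>
        b * c = 0 \<and> best_hus_constant A (matrix_infnorm (matrix_inv A)))"
proof (intro conjI allI impI)
  have entries: "A $ 1 $ 1 = a" "A $ 1 $ 2 = b" "A $ 2 $ 1 = c" "A $ 2 $ 2 = d"
    by (simp_all add: assms)
  show "hyers_ulam_stable A \<longleftrightarrow> hyperbolic A"
    by (rule hyers_ulam_stable_iff_hyperbolic)
  show "matrix_infnorm (matrix_inv A) \<le> K" if "hus_constant A K" for K
    by (rule planar_inverse_norm_le[OF that])
  show "\<exists>B :: real ^ 2 ^ 2. hyers_ulam_stable B \<and> best_hus_constant B (matrix_infnorm (matrix_inv B))"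
  proof
    let ?I = "mat 1 :: real ^ 2 ^ 2"
    have "hus_constant ?I (matrix_infnorm (matrix_inv ?I))"
      by (rule hus_constant_double[of _ 1]) (simp_all add: mat_def)
    then show "hyers_ulam_stable ?I \<and> best_hus_constant ?I (matrix_infnorm (matrix_inv ?I))"
      using planar_best_hus_constant hyers_ulam_stable_def by blast
  qed
  show "best_hus_constant A (matrix_infnorm (matrix_inv A))"
    if ev: "eigenvalue A (of_real l1)" "eigenvalue A (of_real l2)"
      and l: "l1 > l2" "l1 * l2 > 0" "l1 \<ge> a" "a \<ge> l2" for l1 l2
  proof -
    have char_eq: "l\<^sup>2 - (a + d) * l + (a * d - b * c) = 0" if "eigenvalue A (of_real l)" for l
    proof -
      have "complex_of_real (l\<^sup>2 - (a + d) * l + (a * d - b * c)) = 0"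
        using eigenvalue_characteristic_equation[OF that] by (simp add: entries)
      then show ?thesis
        by (simp only: of_real_eq_0_iff)
    qed
    have "(l1 - l2) * (a + d) = (l1 - l2) * (l1 + l2)"
      using char_eq[OF ev(1)] char_eq[OF ev(2)] by algebra
    then have tr: "a + d = l1 + l2"
      using l(1) by simp
    then have det: "a * d - b * c = l1 * l2"
      using char_eq[OF ev(1)] by algebra
    show ?thesis
      using hus_constant_distinct[of A l1 l2] tr det l
      by (intro planar_best_hus_constant) (simp add: entries)
  qed
  show "b * c = 0" "best_hus_constant A (matrix_infnorm (matrix_inv A))"
    if l: "order l (charpoly A) = 2" "l \<noteq> 0" "l = a" for l
  proof -
    have "- (a + d) = - 2 * l" "a * d - b * c = l\<^sup>2"
      using double_root_monic_quadratic[of l "a * d - b * c" "- (a + d)"] l(1)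
      by (simp_all add: charpoly_2 entries)
    then have d: "d = l" and bc: "b * c = 0"
      using l(3) by (simp_all add: power2_eq_square)
    show "b * c = 0"
      by (rule bc)
    show "best_hus_constant A (matrix_infnorm (matrix_inv A))"
      using hus_constant_double[of A l] d bc l(2,3)
      by (intro planar_best_hus_constant) (simp add: entries)
  qed
qed

end
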